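(* Let $k$ be a field of characteristic zero and let $A$ be an associative $k$-algebra, regarded as a Lie algebra via $[a,b]=ab-ba$. Then the square formed by $$\varphi_*:HL_{*+1}(A)\to HH_*(A),\quad I:HH_*(A)\to HC_*(A),\quad \pi:HL_{*+1}(A)\to H^{\mathrm{Lie}}_{*+1}(A),\quad \theta_*:H^{\mathrm{Lie}}_{*+1}(A)\to HC_*(A)$$ commutes: $I\circ\varphi_*=\theta_*\circ\pi$ as maps $HL_{*+1}(A)\to HC_*(A)$.
   Context: Tensor and exterior powers are over $k$; $(a_0,\ldots,a_n)$ denotes $a_0\otimes\cdots\otimes a_n$; $S_n$ is the symmetric group on $\{1,\ldots,n\}$. Leibniz homology $HL_*(A)$ is the homology of $CL_*(A)$: $CL_0(A)=k$, $CL_{n}(A)=A^{\otimes n}$ for $n\ge1$, with differential $0$ from $CL_1(A)=A$ to $k$ and, for $n\ge 1$, $d:A^{\otimes(n+1)}\to A^{\otimes n}$, $$d(a_0\otimes\cdots\otimes a_n)=\sum_{0\le i<j\le n}(-1)^{j+1}(a_0,\ldots,a_{i-1},[a_i,a_j],a_{i+1},\ldots,\widehat{a}_j,\ldots,a_n).$$ Lie-algebra homology $H^{\mathrm{Lie}}_*(A)$ (trivial coefficients) is the homology of the complex $\Lambda^*(A)$ of exterior powers with the differential induced by the same formula, and $\pi$ is induced by the projections $A^{\otimes n}\to A^{\wedge n}$. Hochschild homology $HH_*(A)$ is the homology of $CHH_n(A)=A^{\otimes(n+1)}$, $n\ge0$, with $b=\sum_{i=0}^n(-1)^id_i$, $d_i(a_0,\ldots,a_n)=(a_0,\ldots,a_ia_{i+1},\ldots,a_n)$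 for $0\le i<n$, $d_n(a_0,\ldots,a_n)=(a_na_0,a_1,\ldots,a_{n-1})$. Cyclic homology $HC_*(A)$ is the homology of the quotient complex $C^\lambda_n(A)=A^{\otimes(n+1)}/(1-t)$ with differential induced by $b$, where $t(a_0,\ldots,a_n)=(-1)^n(a_n,a_0,\ldots,a_{n-1})$; $I$ is induced by the projections $A^{\otimes(n+1)}\to A^{\otimes(n+1)}/(1-t)$. $\varphi_*$ is induced by the chain map $\varphi_n:CL_{n+1}(A)\to CHH_n(A)$, $\varphi_n(a_0,\ldots,a_n)=\sum_{\sigma\in S_n}(\mathrm{sgn}\,\sigma)(a_0,a_{\sigma^{-1}(1)},\ldots,a_{\sigma^{-1}(n)})$. $\theta_*$ is induced by the chain map $\theta:\Lambda^{n+1}(A)\to C^\lambda_n(A)$, $\theta(a_0\wedge a_1\wedge\cdots\wedge a_n)=\sum_{\sigma\in S_n}(\mathrm{sgn}\,\sigma)(a_0,a_{\sigma^{-1}(1)},\ldots,a_{\sigma^{-1}(n)})$. *)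

theory Defs
  imports
    Complex_Main
    "HOL-Algebra.Coset"
    "HOL-Combinatorics.Permutations"
    "HOL-Library.Poly_Mapping"
begin

section \<open>Associative algebras over a field\<close>

text \<open>
  The algebra is not required to have a unit: neither the complexes nor the maps between them
  use one. Unital algebras are the special case in which the type \<open>'a\<close> is also of class
  \<open>ring_1\<close>.
\<close>

locale assoc_algebra = vector_space scale
  for scale :: "'k::field \<Rightarrow> 'a::ring \<Rightarrow> 'a" +
  assumes scale_mult_left: "scale c x * y = scale c (x * y)"
    and scale_mult_right: "x * scale c y = scale c (x * y)"

definition bracket :: "'a::ring \<Rightarrow> 'a \<Rightarrow> 'a" where
  "bracket a b = a * b - b * a"


section \<open>Maps into quotient groups and homology\<close>

text \<open>
  All groups below are abelian, and are written as records of \<open>HOL-Algebra\<close>, so that quotients are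
  the library's \<open>G Mod H\<close>. If \<open>f\<close> is a homomorphism into \<open>G\<close> which maps a subgroup \<open>K\<close> of its
  domain into \<open>H\<close>, then the composite of \<open>f\<close> with the projection onto \<open>G Mod H\<close> is constant on each
  coset \<open>X\<close> of \<open>K\<close>, and its value on \<open>X\<close> is the image of \<open>X\<close> under the homomorphism induced on the
  quotients.
\<close>

definition quot_map :: "('b, 'm) monoid_scheme \<Rightarrow> 'b set \<Rightarrow> ('c \<Rightarrow> 'b) \<Rightarrow> 'c set \<Rightarrow> 'b set" where
  "quot_map G H f X = the_elem ((\<lambda>x. H #>\<^bsub>G\<^esub> f x) ` X)"

lemma quot_map_coset:
  assumes "group D" "group G" and K: "subgroup K D" and H: "subgroup H G"
    and f: "f \<in> hom D G" and fK: "f ` K \<subseteq> H" and x: "x \<in> carrier D"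
  shows "quot_map G H f (K #>\<^bsub>D\<^esub> x) = H #>\<^bsub>G\<^esub> f x"
proof -
  interpret D: group D by fact
  interpret G: group G by fact
  have "H #>\<^bsub>G\<^esub> f y = H #>\<^bsub>G\<^esub> f x" if "y \<in> K #>\<^bsub>D\<^esub> x" for y
  proof -
    from that obtain k where k: "k \<in> K" "y = k \<otimes>\<^bsub>D\<^esub> x"
      by (auto simp: r_coset_def)
    have kD: "k \<in> carrier D" using k K by (meson subgroup.mem_carrier)
    have fk: "f k \<in> H" using k fK by auto
    have fkG: "f k \<in> carrier G" and fxG: "f x \<in> carrier G"
      using kD x f by (auto simp: hom_def)
    have "H #>\<^bsub>G\<^esub> f y = H #>\<^bsub>G\<^esub> (f k \<otimes>\<^bsub>G\<^esub> f x)"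
      using k kD x f by (simp add: hom_mult)
    also have "\<dots> = (H #>\<^bsub>G\<^esub> f k) #>\<^bsub>G\<^esub> f x"
      using G.coset_mult_assoc[OF subgroup.subset[OF H] fkG fxG] by simp
    also have "H #>\<^bsub>G\<^esub> f k = H"
      using G.coset_join2[OF fkG H fk] .
    finally show ?thesis .
  qed
  moreover have "x \<in> K #>\<^bsub>D\<^esub> x" using D.rcos_self[OF x K] .
  ultimately have "(\<lambda>y. H #>\<^bsub>G\<^esub> f y) ` (K #>\<^bsub>D\<^esub> x) = {H #>\<^bsub>G\<^esub> f x}"
    by blast
  then show ?thesis by (simp add: quot_map_def)
qed

text \<open>
  A chain complex is a pair \<open>C\<close>, \<open>d\<close> where \<open>d n\<close> maps \<open>C (Suc n)\<close> to \<open>C n\<close>; there is nothing in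
  negative degrees.
\<close>

fun cycles :: "(nat \<Rightarrow> ('b, 'm) monoid_scheme) \<Rightarrow> (nat \<Rightarrow> 'b \<Rightarrow> 'b) \<Rightarrow> nat \<Rightarrow> 'b set" where
  "cycles C d 0 = carrier (C 0)"
| "cycles C d (Suc n) = kernel (C (Suc n)) (C n) (d n)"

definition boundaries :: "(nat \<Rightarrow> ('b, 'm) monoid_scheme) \<Rightarrow> (nat \<Rightarrow> 'b \<Rightarrow> 'b) \<Rightarrow> nat \<Rightarrow> 'b set" where
  "boundaries C d n = d n ` carrier (C (Suc n))"

definition homology ::
  "(nat \<Rightarrow> ('b, 'm) monoid_scheme) \<Rightarrow> (nat \<Rightarrow> 'b \<Rightarrow> 'b) \<Rightarrow> nat \<Rightarrow> 'b set monoid" where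
  "homology C d n = (C n\<lparr>carrier := cycles C d n\<rparr>) Mod boundaries C d n"

text \<open>
  The map on homology induced by a chain map; \<open>C\<close>, \<open>d\<close> is the target complex, \<open>n\<close> the degree in
  the target and \<open>f\<close> the component of the chain map landing in degree \<open>n\<close>.
\<close>

definition homology_map ::
  "(nat \<Rightarrow> ('b, 'm) monoid_scheme) \<Rightarrow> (nat \<Rightarrow> 'b \<Rightarrow> 'b) \<Rightarrow> nat \<Rightarrow> ('c \<Rightarrow> 'b) \<Rightarrow> 'c set \<Rightarrow> 'b set" where
  "homology_map C d n f = quot_map (C n\<lparr>carrier := cycles C d n\<rparr>) (boundaries C d n) f"


section \<open>Tensor powers\<close>

text \<open>
  The \<open>n\<close>-th tensor power is the free vector space on the words of length \<open>n\<close> in \<open>A\<close> modulo the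
  subspace expressing multilinearity. For \<open>n = 0\<close> there is one word and no relation, so the
  result is the ground field.
\<close>

type_synonym ('a, 'k) comb = "'a list \<Rightarrow>\<^sub>0 'k"

definition comb_scale :: "'k::field \<Rightarrow> ('a, 'k) comb \<Rightarrow> ('a, 'k) comb" where
  "comb_scale c p = Poly_Mapping.map ((*) c) p"

lemma lookup_comb_scale: "Poly_Mapping.lookup (comb_scale c p) w = c * Poly_Mapping.lookup p w"
  by (simp add: comb_scale_def Poly_Mapping.map.rep_eq when_def)

lemma vector_space_comb_scale: "vector_space comb_scale"
  by unfold_locales
    (auto intro!: poly_mapping_eqI simp: lookup_comb_scale lookup_add algebra_simps)

definition free_words :: "nat \<Rightarrow> ('a, 'k::field) comb monoid" where
  "free_words n =
     \<lparr>carrier = {p. \<forall>w \<in> Poly_Mapping.keys p. length w = n}, monoid.mult = (+), one = 0\<rparr>"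

definition linear_extension ::
  "('b list \<Rightarrow> ('a, 'k) comb) \<Rightarrow> ('b, 'k::field) comb \<Rightarrow> ('a, 'k) comb" where
  "linear_extension f p =
     (\<Sum>w \<in> Poly_Mapping.keys p. comb_scale (Poly_Mapping.lookup p w) (f w))"

definition multilinear_relations ::
  "('k::field \<Rightarrow> 'a::ring \<Rightarrow> 'a) \<Rightarrow> nat \<Rightarrow> ('a, 'k) comb set" where
  "multilinear_relations scale n = module.span comb_scale
     ({Poly_Mapping.single (u @ (x + y) # v) 1
         - Poly_Mapping.single (u @ x # v) 1 - Poly_Mapping.single (u @ y # v) 1
       | u x y v. length u + 1 + length v = n}
    \<union> {Poly_Mapping.single (u @ scale c x # v) 1 - Poly_Mapping.single (u @ x # v) c
       | u c x v. length u + 1 + length v = n})"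

definition tensor_power ::
  "('k::field \<Rightarrow> 'a::ring \<Rightarrow> 'a) \<Rightarrow> nat \<Rightarrow> ('a, 'k) comb set monoid" where
  "tensor_power scale n = free_words n Mod multilinear_relations scale n"

text \<open>
  The linear map into the \<open>m\<close>-th tensor power which sends \<open>a\<^sub>1 \<otimes> \<dots> \<otimes> a\<^sub>n\<close> to the class of
  \<open>f [a\<^sub>1, \<dots>, a\<^sub>n]\<close>, where \<open>f\<close> is multilinear up to \<open>multilinear_relations scale m\<close>.
\<close>

definition tensor_map ::
  "('k::field \<Rightarrow> 'a::ring \<Rightarrow> 'a) \<Rightarrow> nat \<Rightarrow> ('a list \<Rightarrow> ('a, 'k) comb)
     \<Rightarrow> ('a, 'k) comb set \<Rightarrow> ('a, 'k) comb set" where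
  "tensor_map scale m f =
     quot_map (free_words m) (multilinear_relations scale m) (linear_extension f)"


section \<open>Leibniz homology\<close>

text \<open>The sum is empty on words of length at most one.\<close>

definition leibniz_word :: "'a::ring list \<Rightarrow> ('a, 'k::field) comb" where
  "leibniz_word w =
     (\<Sum>(i, j) \<in> {(i, j). i < j \<and> j < length w}.
        Poly_Mapping.single
          (take i w @ bracket (w ! i) (w ! j) # drop (Suc i) (take j w) @ drop (Suc j) w)
          ((-1) ^ (j + 1)))"

definition CL_d ::
  "('k::field \<Rightarrow> 'a::ring \<Rightarrow> 'a) \<Rightarrow> nat \<Rightarrow> ('a, 'k) comb set \<Rightarrow> ('a, 'k) comb set" where
  "CL_d scale n = tensor_map scale n leibniz_word"

definition HL :: "('k::field \<Rightarrow> 'a::ring \<Rightarrow> 'a) \<Rightarrow> nat \<Rightarrow> ('a, 'k) comb set set monoid" where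
  "HL scale = homology (tensor_power scale) (CL_d scale)"


section \<open>Lie algebra homology\<close>

definition alternating_subspace ::
  "('k::field \<Rightarrow> 'a::ring \<Rightarrow> 'a) \<Rightarrow> nat \<Rightarrow> ('a, 'k) comb set set" where
  "alternating_subspace scale n =
     (\<lambda>p. multilinear_relations scale n #>\<^bsub>free_words n\<^esub> p) `
       module.span comb_scale {Poly_Mapping.single w 1 | w. length w = n \<and> \<not> distinct w}"

definition exterior_power ::
  "('k::field \<Rightarrow> 'a::ring \<Rightarrow> 'a) \<Rightarrow> nat \<Rightarrow> ('a, 'k) comb set set monoid" where
  "exterior_power scale n = tensor_power scale n Mod alternating_subspace scale n"

definition exterior_d ::
  "('k::field \<Rightarrow> 'a::ring \<Rightarrow> 'a) \<Rightarrow> nat \<Rightarrow> ('a, 'k) comb set set \<Rightarrow> ('a, 'k) comb set set" where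
  "exterior_d scale n =
     quot_map (tensor_power scale n) (alternating_subspace scale n) (CL_d scale n)"

definition HLie :: "('k::field \<Rightarrow> 'a::ring \<Rightarrow> 'a) \<Rightarrow> nat \<Rightarrow> ('a, 'k) comb set set set monoid" where
  "HLie scale = homology (exterior_power scale) (exterior_d scale)"

definition pi_star ::
  "('k::field \<Rightarrow> 'a::ring \<Rightarrow> 'a) \<Rightarrow> nat \<Rightarrow> ('a, 'k) comb set set \<Rightarrow> ('a, 'k) comb set set set" where
  "pi_star scale n = homology_map (exterior_power scale) (exterior_d scale) n
     (\<lambda>x. alternating_subspace scale n #>\<^bsub>tensor_power scale n\<^esub> x)"


section \<open>Hochschild homology\<close>

text \<open>The faces \<open>d\<^sub>i\<close> on a word \<open>[a\<^sub>0, \<dots>, a\<^sub>n]\<close> of length \<open>n + 1 \<ge> 2\<close>.\<close>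

definition face :: "nat \<Rightarrow> 'a::ring list \<Rightarrow> 'a list" where
  "face i w =
     (if Suc i < length w then take i w @ (w ! i * w ! Suc i) # drop (i + 2) w
      else (last w * hd w) # tl (butlast w))"

definition hochschild_word :: "'a::ring list \<Rightarrow> ('a, 'k::field) comb" where
  "hochschild_word w = (\<Sum>i < length w. Poly_Mapping.single (face i w) ((-1) ^ i))"

definition CHH ::
  "('k::field \<Rightarrow> 'a::ring \<Rightarrow> 'a) \<Rightarrow> nat \<Rightarrow> ('a, 'k) comb set monoid" where
  "CHH scale n = tensor_power scale (Suc n)"

definition CHH_b ::
  "('k::field \<Rightarrow> 'a::ring \<Rightarrow> 'a) \<Rightarrow> nat \<Rightarrow> ('a, 'k) comb set \<Rightarrow> ('a, 'k) comb set" where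
  "CHH_b scale n = tensor_map scale (Suc n) hochschild_word"

definition HH :: "('k::field \<Rightarrow> 'a::ring \<Rightarrow> 'a) \<Rightarrow> nat \<Rightarrow> ('a, 'k) comb set set monoid" where
  "HH scale = homology (CHH scale) (CHH_b scale)"


section \<open>Cyclic homology\<close>

definition cyclic_word :: "'a list \<Rightarrow> ('a, 'k::field) comb" where
  "cyclic_word w = Poly_Mapping.single (last w # butlast w) ((-1) ^ (length w - 1))"

definition one_minus_t_image ::
  "('k::field \<Rightarrow> 'a::ring \<Rightarrow> 'a) \<Rightarrow> nat \<Rightarrow> ('a, 'k) comb set set" where
  "one_minus_t_image scale n =
     tensor_map scale (Suc n) (\<lambda>w. Poly_Mapping.single w 1 - cyclic_word w)
       ` carrier (CHH scale n)"

definition Clambda ::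
  "('k::field \<Rightarrow> 'a::ring \<Rightarrow> 'a) \<Rightarrow> nat \<Rightarrow> ('a, 'k) comb set set monoid" where
  "Clambda scale n = CHH scale n Mod one_minus_t_image scale n"

definition Clambda_b ::
  "('k::field \<Rightarrow> 'a::ring \<Rightarrow> 'a) \<Rightarrow> nat \<Rightarrow> ('a, 'k) comb set set \<Rightarrow> ('a, 'k) comb set set" where
  "Clambda_b scale n = quot_map (CHH scale n) (one_minus_t_image scale n) (CHH_b scale n)"

definition HC :: "('k::field \<Rightarrow> 'a::ring \<Rightarrow> 'a) \<Rightarrow> nat \<Rightarrow> ('a, 'k) comb set set set monoid" where
  "HC scale = homology (Clambda scale) (Clambda_b scale)"

definition I_star ::
  "('k::field \<Rightarrow> 'a::ring \<Rightarrow> 'a) \<Rightarrow> nat \<Rightarrow> ('a, 'k) comb set set \<Rightarrow> ('a, 'k) comb set set set" where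
  "I_star scale n = homology_map (Clambda scale) (Clambda_b scale) n
     (\<lambda>x. one_minus_t_image scale n #>\<^bsub>CHH scale n\<^esub> x)"


section \<open>The maps \<open>\<phi>\<close> and \<open>\<theta>\<close>\<close>

text \<open>
  On a word \<open>[a\<^sub>0, \<dots>, a\<^sub>n]\<close>, the first letter is kept and the others are permuted.
\<close>

definition antisym_word :: "'a list \<Rightarrow> ('a, 'k::field) comb" where
  "antisym_word w =
     (\<Sum>\<sigma> \<in> {\<sigma>. \<sigma> permutes {1..length w - 1}}.
        Poly_Mapping.single (w ! 0 # map (\<lambda>i. w ! inv_into UNIV \<sigma> i) [1..<length w])
          (of_int (sign \<sigma>)))"

definition phi ::
  "('k::field \<Rightarrow> 'a::ring \<Rightarrow> 'a) \<Rightarrow> nat \<Rightarrow> ('a, 'k) comb set \<Rightarrow> ('a, 'k) comb set" where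
  "phi scale n = tensor_map scale (Suc n) antisym_word"

definition phi_star ::
  "('k::field \<Rightarrow> 'a::ring \<Rightarrow> 'a) \<Rightarrow> nat \<Rightarrow> ('a, 'k) comb set set \<Rightarrow> ('a, 'k) comb set set" where
  "phi_star scale n = homology_map (CHH scale) (CHH_b scale) n (phi scale n)"

text \<open>
  An element of the exterior power is a coset of tensors; \<open>\<theta>\<close> is given by the same formula as
  \<open>\<phi>\<close>, applied to a tensor in the coset and read modulo the image of \<open>1 - t\<close>.
\<close>

definition theta ::
  "('k::field \<Rightarrow> 'a::ring \<Rightarrow> 'a) \<Rightarrow> nat \<Rightarrow> ('a, 'k) comb set set \<Rightarrow> ('a, 'k) comb set set" where
  "theta scale n = quot_map (CHH scale n) (one_minus_t_image scale n)
     (tensor_map scale (Suc n) antisym_word)"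

definition theta_star ::
  "('k::field \<Rightarrow> 'a::ring \<Rightarrow> 'a) \<Rightarrow> nat \<Rightarrow> ('a, 'k) comb set set set
     \<Rightarrow> ('a, 'k) comb set set set" where
  "theta_star scale n = homology_map (Clambda scale) (Clambda_b scale) n (theta scale n)"

end

theory Submission
  imports Defs
begin

text \<open>
  On chains the square commutes almost by definition: both composites antisymmetrise the letters
  behind the first one and read the result modulo the image of \<open>1 - t\<close>. The content of the theorem
  is that all four maps exist, that is, that the formulas are compatible with the relations that
  define tensor powers, exterior powers and the cyclic complex, and with the differentials. Then
  all maps on homology may be evaluated on representatives. Four compatibilities carry the proof.

  First, \<open>\<phi>\<close> is a chain map from the Leibniz to the Hochschild complex. The antisymmetriser is built
  by signed insertion of one letter at a time. Multiplication of neighbouring letters anticommutes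
  with the insertion of \<open>a\<close> up to the derivation \<open>[a, -]\<close> (\<open>bar_insertion\<close>), and the antisymmetriser
  turns the brackets of \<open>a\<close> with later letters into the same derivation (\<open>alternating_contract\<close>).
  This matches the inner faces of the Hochschild boundary with the brackets that do not involve the
  first letter. The two outer faces form the brackets with the first letter
  (\<open>alternating_tail_contract\<close>). The lemma \<open>antisym_word_eq\<close> identifies the recursive
  antisymmetriser with the sum over permutations.

  Second, \<open>b (1 - t) = (1 - t) b'\<close> (\<open>hochschild_one_minus_t_word\<close>), so that \<open>b\<close> passes to the cyclic
  complex.

  Third, \<open>\<phi>\<close> maps a word with a repeated letter into the image of \<open>1 - t\<close>
  (\<open>antisym_word_not_distinct\<close>), so that \<open>\<theta>\<close> is defined on exterior powers. Modulo rotations the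
  full antisymmetriser of \<open>n + 1\<close> letters is \<open>n + 1\<close> times \<open>\<phi>\<close>; it vanishes on a word with a
  repeated letter, and \<open>n + 1\<close> is invertible.

  Fourth, the Leibniz differential preserves the relations of the exterior powers
  (\<open>leibniz_alternating_rels\<close>), so that it passes to the Lie algebra complex and \<open>\<pi>\<close> is a chain
  map. By polarisation two equal letters may be assumed to be neighbours, and then the terms cancel
  in pairs.

  The computations take place with formal combinations of words, before passing to quotients, and
  most of them are identities of linear operators that follow by induction on the word.
\<close>

section \<open>Linear maps on combinations of words\<close>

interpretation comb: vector_space comb_scale
  by (rule vector_space_comb_scale)

abbreviation word :: "'a list \<Rightarrow> ('a, 'k::field) comb" where
  "word w \<equiv> Poly_Mapping.single w 1"

abbreviation comb_linear ::
  "(('a, 'k::field) comb \<Rightarrow> ('b, 'k) comb) \<Rightarrow> bool" where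
  "comb_linear \<equiv> module_hom comb_scale comb_scale"

lemma comb_linearI:
  assumes "\<And>p q. F (p + q) = F p + F q" "\<And>c p. F (comb_scale c p) = comb_scale c (F p)"
  shows "comb_linear F"
  using assms by unfold_locales

lemma comb_scale_single [simp]:
  "comb_scale c (Poly_Mapping.single w d) = Poly_Mapping.single w (c * d)"
  by (rule poly_mapping_eqI) (simp add: lookup_comb_scale lookup_single when_def)

lemma keys_comb_scale: "Poly_Mapping.keys (comb_scale c p) \<subseteq> Poly_Mapping.keys p"
  by (auto simp: in_keys_iff lookup_comb_scale)

lemma linear_extension_superset:
  assumes "finite T" "Poly_Mapping.keys p \<subseteq> T"
  shows "linear_extension f p = (\<Sum>w\<in>T. comb_scale (Poly_Mapping.lookup p w) (f w))"
  unfolding linear_extension_def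
  using assms by (intro sum.mono_neutral_left) (auto simp: in_keys_iff)

lemma linear_extension_linear:
  fixes f :: "'b list \<Rightarrow> ('a, 'k::field) comb"
  shows "comb_linear (linear_extension f)"
proof (rule comb_linearI)
  fix p q :: "('b, 'k) comb" and c :: 'k
  let ?T = "Poly_Mapping.keys p \<union> Poly_Mapping.keys q"
  have "Poly_Mapping.keys (p + q) \<subseteq> ?T" by (rule Poly_Mapping.keys_add)
  then show "linear_extension f (p + q) = linear_extension f p + linear_extension f q"
    by (simp add: linear_extension_superset[of ?T] lookup_add comb.scale_left_distrib sum.distrib)
  show "linear_extension f (comb_scale c p) = comb_scale c (linear_extension f p)"
    using keys_comb_scale[of c p]
    by (simp add: linear_extension_superset[of "Poly_Mapping.keys p"] lookup_comb_scale
        comb.scale_sum_right)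
qed

lemma linear_extension_single [simp]:
  "linear_extension f (Poly_Mapping.single w c) = comb_scale c (f w)"
  by (simp add: linear_extension_superset[of "{w}"])

lemmas linear_extension_simps [simp] =
  module_hom.zero[OF linear_extension_linear] module_hom.add[OF linear_extension_linear]
  module_hom.neg[OF linear_extension_linear] module_hom.diff[OF linear_extension_linear]
  module_hom.scale[OF linear_extension_linear] module_hom.sum[OF linear_extension_linear]

lemma comb_linear_id: "comb_linear (\<lambda>p. p)"
  by (rule comb_linearI) auto

lemma comb_linear_zero: "comb_linear (\<lambda>p. 0)"
  by (rule comb_linearI) auto

lemma comb_linear_extension: "comb_linear F \<Longrightarrow> comb_linear (\<lambda>p. linear_extension f (F p))"
  by (rule comb_linearI) (simp_all add: module_hom.add module_hom.scale)

lemma comb_linear_add: "comb_linear F \<Longrightarrow> comb_linear G \<Longrightarrow> comb_linear (\<lambda>p. F p + G p)"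
  by (rule comb_linearI) (simp_all add: module_hom.add module_hom.scale comb.scale_right_distrib)

lemma comb_linear_diff: "comb_linear F \<Longrightarrow> comb_linear G \<Longrightarrow> comb_linear (\<lambda>p. F p - G p)"
  by (rule comb_linearI) (simp_all add: module_hom.add module_hom.scale comb.scale_right_diff_distrib)

lemma comb_linear_minus: "comb_linear F \<Longrightarrow> comb_linear (\<lambda>p. - F p)"
  by (rule comb_linearI) (simp_all add: module_hom.add module_hom.scale)

lemma comb_linear_scale: "comb_linear F \<Longrightarrow> comb_linear (\<lambda>p. comb_scale c (F p))"
  by (rule comb_linearI)
    (simp_all add: module_hom.add module_hom.scale comb.scale_right_distrib mult.commute)

lemma comb_linear_sum:
  assumes "\<And>i. i \<in> I \<Longrightarrow> comb_linear (F i)"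
  shows "comb_linear (\<lambda>p. \<Sum>i\<in>I. F i p)"
proof (rule comb_linearI)
  show "(\<Sum>i\<in>I. F i (p + q)) = (\<Sum>i\<in>I. F i p) + (\<Sum>i\<in>I. F i q)" for p q
    unfolding sum.distrib[symmetric] by (rule sum.cong) (simp_all add: module_hom.add[OF assms])
  show "(\<Sum>i\<in>I. F i (comb_scale c p)) = comb_scale c (\<Sum>i\<in>I. F i p)" for c p
    unfolding comb.scale_sum_right by (rule sum.cong) (simp_all add: module_hom.scale[OF assms])
qed

lemma comb_expansion:
  "p = (\<Sum>w\<in>Poly_Mapping.keys p. comb_scale (Poly_Mapping.lookup p w) (word w))"
  (is "_ = ?q")
proof (rule poly_mapping_eqI)
  fix v
  show "Poly_Mapping.lookup p v = Poly_Mapping.lookup ?q v"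
    by (cases "v \<in> Poly_Mapping.keys p")
      (auto simp: Poly_Mapping.lookup_sum lookup_single when_def in_keys_iff)
qed

lemma comb_linear_expansion:
  assumes "comb_linear F"
  shows "F p = (\<Sum>w\<in>Poly_Mapping.keys p. comb_scale (Poly_Mapping.lookup p w) (F (word w)))"
  using assms
  by (subst comb_expansion) (simp add: module_hom.sum module_hom.scale del: comb_scale_single)

text \<open>
  Identities between operators on tensors are checked on words. Restricting to the words that occur
  in \<open>p\<close> allows the signs of the operators to depend on the length of the word, if \<open>p\<close> is
  homogeneous.
\<close>

lemma comb_linear_eq_on_keys:
  assumes "comb_linear F" "comb_linear G"
    and "\<And>w. w \<in> Poly_Mapping.keys p \<Longrightarrow> F (word w) = G (word w)"
  shows "F p = G p"
  unfolding comb_linear_expansion[OF assms(1), of p] comb_linear_expansion[OF assms(2), of p]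
  using assms(3) by (auto intro: sum.cong)

lemma comb_linear_eqI:
  assumes "comb_linear F" "comb_linear G" "\<And>w. F (word w) = G (word w)"
  shows "F p = G p"
  using assms by (rule comb_linear_eq_on_keys)

lemma linear_map_in_subspace:
  assumes "comb_linear F" "module.subspace comb_scale V"
    and "\<And>w. w \<in> Poly_Mapping.keys p \<Longrightarrow> F (word w) \<in> V"
  shows "F p \<in> V"
  unfolding comb_linear_expansion[OF assms(1), of p] using assms(2,3)
  by (auto intro!: comb.subspace_sum comb.subspace_scale)

lemma span_linear_image:
  assumes "comb_linear F" "comb.subspace V" "\<And>p. p \<in> S \<Longrightarrow> F p \<in> V" "p \<in> comb.span S"
  shows "F p \<in> V"
proof -
  have "comb.span S \<subseteq> {p. F p \<in> V}"
  proof (rule comb.span_minimal)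
    show "comb.subspace {p. F p \<in> V}"
      by (rule comb.subspaceI)
        (simp_all add: module_hom.zero[OF assms(1)] module_hom.add[OF assms(1)]
          module_hom.scale[OF assms(1)] comb.subspace_0[OF assms(2)]
          comb.subspace_add[OF assms(2)] comb.subspace_scale[OF assms(2)])
  qed (use assms(3) in auto)
  then show ?thesis using assms(4) by auto
qed

lemma mem_free_words_iff:
  "p \<in> carrier (free_words n) \<longleftrightarrow> (\<forall>w \<in> Poly_Mapping.keys p. length w = n)"
  by (simp add: free_words_def)

lemma free_words_subspace: "comb.subspace (carrier (free_words n))"
  by (rule comb.subspaceI)
    (use keys_comb_scale Poly_Mapping.keys_add in \<open>fastforce simp: mem_free_words_iff\<close>)+

lemma single_mem_free_words: "length w = n \<Longrightarrow> Poly_Mapping.single w c \<in> carrier (free_words n)"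
  by (simp add: mem_free_words_iff)

lemma linear_extension_mem_subspace:
  assumes "comb.subspace V" "p \<in> carrier (free_words n)" "\<And>w. length w = n \<Longrightarrow> f w \<in> V"
  shows "linear_extension f p \<in> V"
  using linear_extension_linear assms(1)
  by (rule linear_map_in_subspace) (use assms(2,3) in \<open>simp add: mem_free_words_iff\<close>)

text \<open>
  Left multiplication by a letter in the tensor algebra. It is kept opaque, with its own
  simplification rules, so that operator identities are rewritten without unfolding to words.
\<close>

definition prepend :: "'a \<Rightarrow> ('a, 'k::field) comb \<Rightarrow> ('a, 'k) comb" where
  "prepend x = linear_extension (\<lambda>w. word (x # w))"

lemma prepend_linear: "comb_linear (prepend x)"
  by (simp add: prepend_def linear_extension_linear)

lemma prepend_single [simp]: "prepend x (Poly_Mapping.single w c) = Poly_Mapping.single (x # w) c"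
  by (simp add: prepend_def)

lemmas prepend_simps [simp] =
  module_hom.zero[OF prepend_linear] module_hom.add[OF prepend_linear]
  module_hom.neg[OF prepend_linear] module_hom.diff[OF prepend_linear]
  module_hom.scale[OF prepend_linear] module_hom.sum[OF prepend_linear]

lemma comb_linear_prepend: "comb_linear F \<Longrightarrow> comb_linear (\<lambda>p. prepend x (F p))"
  unfolding prepend_def by (rule comb_linear_extension)

definition append_letter :: "'a \<Rightarrow> ('a, 'k::field) comb \<Rightarrow> ('a, 'k) comb" where
  "append_letter y = linear_extension (\<lambda>w. word (w @ [y]))"

lemma append_letter_linear: "comb_linear (append_letter y)"
  by (simp add: append_letter_def linear_extension_linear)

lemma append_letter_single [simp]:
  "append_letter y (Poly_Mapping.single w c) = Poly_Mapping.single (w @ [y]) c"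
  by (simp add: append_letter_def)

lemmas append_letter_simps [simp] =
  module_hom.zero[OF append_letter_linear] module_hom.add[OF append_letter_linear]
  module_hom.neg[OF append_letter_linear] module_hom.diff[OF append_letter_linear]
  module_hom.scale[OF append_letter_linear] module_hom.sum[OF append_letter_linear]

lemma comb_linear_append_letter: "comb_linear F \<Longrightarrow> comb_linear (\<lambda>p. append_letter y (F p))"
  unfolding append_letter_def by (rule comb_linear_extension)

lemmas comb_linear_intros =
  comb_linear_id comb_linear_zero comb_linear_extension comb_linear_add comb_linear_diff
  comb_linear_minus comb_linear_scale comb_linear_sum comb_linear_prepend comb_linear_append_letter

section \<open>Alternating insertion and antisymmetrisation\<close>

text \<open>
  \<open>insert_word a w\<close> is the sum of all words that arise by inserting \<open>a\<close> into \<open>w\<close>, the insertion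
  after the first \<open>i\<close> letters having the sign \<open>(-1)\<^sup>i\<close>: the shuffle product of \<open>a\<close> with \<open>w\<close>. In
  the recursion either \<open>a\<close> goes in front, or it passes the first letter at the cost of a sign.
\<close>

fun insert_word :: "'a \<Rightarrow> 'a list \<Rightarrow> ('a, 'k::field) comb" where
  "insert_word a [] = word [a]"
| "insert_word a (x # w) = word (a # x # w) - prepend x (insert_word a w)"

abbreviation insertion :: "'a \<Rightarrow> ('a, 'k::field) comb \<Rightarrow> ('a, 'k) comb" where
  "insertion a \<equiv> linear_extension (insert_word a)"

text \<open>
  The antisymmetriser: inserting the letters one after the other produces every rearrangement
  exactly once, with the sign of the permutation.
\<close>

fun alternating_word :: "'a list \<Rightarrow> ('a, 'k::field) comb" where
  "alternating_word [] = word []"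
| "alternating_word (a # w) = insertion a (alternating_word w)"

lemma insertion_prepend:
  "insertion a (prepend x p) = prepend a (prepend x p) - prepend x (insertion a p)"
  by (rule comb_linear_eqI[where p = p], (intro comb_linear_intros)+) simp

lemma insertion_insertion_word:
  "insertion a (insert_word b w) = - insertion b (insert_word a w)"
proof (induction w)
  case (Cons x w)
  show ?case
    by (simp add: insertion_prepend Cons)
qed simp

text \<open>
  The signed shuffle product is graded commutative, and letters have odd degree.
\<close>

lemma insertion_insertion: "insertion a (insertion b p) = - insertion b (insertion a p)"
  by (rule comb_linear_eqI[where p = p], (intro comb_linear_intros)+)
    (simp add: insertion_insertion_word[of a b])

section \<open>Products of neighbouring letters\<close>

text \<open>
  The derivation of the tensor algebra that extends the commutator with \<open>a\<close>. The commutator of two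
  letters is written as a difference of two words rather than as one word with the letter
  \<open>a * b - b * a\<close>. Every identity of this and the next section then holds for combinations of
  words, without any appeal to multilinearity.
\<close>

fun ad_word :: "'a::ring \<Rightarrow> 'a list \<Rightarrow> ('a, 'k::field) comb" where
  "ad_word a [] = 0"
| "ad_word a (x # w) = word ((a * x) # w) - word ((x * a) # w) + prepend x (ad_word a w)"

abbreviation ad :: "'a::ring \<Rightarrow> ('a, 'k::field) comb \<Rightarrow> ('a, 'k) comb" where
  "ad a \<equiv> linear_extension (ad_word a)"

lemma ad_prepend: "ad a (prepend x p) = prepend (a * x) p - prepend (x * a) p + prepend x (ad a p)"
  by (rule comb_linear_eqI[where p = p], (intro comb_linear_intros)+) simp

lemma ad_insertion_word:
  "ad a (insert_word b w) = insert_word (a * b) w - insert_word (b * a) w + insertion b (ad_word a w)"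
proof (induction w)
  case (Cons x w)
  show ?case by (simp add: ad_prepend insertion_prepend Cons)
qed simp

text \<open>
  A derivation acts on the signed shuffle product by the Leibniz rule.
\<close>

lemma ad_insertion:
  "ad a (insertion b p) = insertion (a * b) p - insertion (b * a) p + insertion b (ad a p)"
  by (rule comb_linear_eqI[where p = p], (intro comb_linear_intros)+) (simp add: ad_insertion_word)

text \<open>
  The products that involve the letter \<open>x\<close> standing in front of \<open>w\<close>: here the first face of
  \<open>x # w\<close>, below (\<open>last_mult_word\<close>) the last one.
\<close>

fun head_mult_word :: "'a::ring \<Rightarrow> 'a list \<Rightarrow> ('a, 'k::field) comb" where
  "head_mult_word x [] = 0"
| "head_mult_word x (y # w) = word ((x * y) # w)"

abbreviation head_mult :: "'a::ring \<Rightarrow> ('a, 'k::field) comb \<Rightarrow> ('a, 'k) comb" where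
  "head_mult x \<equiv> linear_extension (head_mult_word x)"

text \<open>
  The differential of the bar construction: minus the alternating sum of those faces which
  multiply two neighbouring letters.
\<close>

fun bar_word :: "'a::ring list \<Rightarrow> ('a, 'k::field) comb" where
  "bar_word [] = 0"
| "bar_word (x # w) = - head_mult_word x w - prepend x (bar_word w)"

abbreviation bar :: "('a::ring, 'k::field) comb \<Rightarrow> ('a, 'k) comb" where
  "bar \<equiv> linear_extension bar_word"

lemma head_mult_prepend: "head_mult x (prepend y p) = prepend (x * y) p"
  by (rule comb_linear_eqI[where p = p], (intro comb_linear_intros)+) simp

lemma bar_prepend: "bar (prepend x p) = - head_mult x p - prepend x (bar p)"
  by (rule comb_linear_eqI[where p = p], (intro comb_linear_intros)+) simp

lemma head_mult_insertion_word:
  "head_mult x (insert_word a w)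
    = insertion a (head_mult_word x w) + word ((x * a) # w) - prepend a (head_mult_word x w)"
  by (cases w) (simp_all add: head_mult_prepend)

lemma bar_insertion_word:
  "bar (insert_word a w) = - insertion a (bar_word w) - ad_word a w"
proof (induction w)
  case (Cons x w)
  show ?case
    by (simp add: bar_prepend head_mult_insertion_word insertion_prepend Cons)
qed simp

text \<open>
  Inserting \<open>a\<close> and then multiplying neighbours either multiplies two old letters, which is the
  first term on the right, or multiplies \<open>a\<close> with a neighbour. The product of \<open>a\<close> with its right
  neighbour and the product with its left neighbour occur for two consecutive positions of \<open>a\<close>,
  hence with opposite signs, and together they form a commutator. So \<open>ad a\<close> is the anticommutator
  of \<open>bar\<close> and \<open>insertion a\<close> up to sign, as in Cartan's formula.
\<close>

lemma bar_insertion: "bar (insertion a p) = - insertion a (bar p) - ad a p"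
  by (rule comb_linear_eqI[where p = p], (intro comb_linear_intros)+) (simp add: bar_insertion_word)

lemma prepend_mem_free_words:
  "p \<in> carrier (free_words n) \<Longrightarrow> prepend x p \<in> carrier (free_words (Suc n))"
  unfolding prepend_def
  by (erule linear_extension_mem_subspace[OF free_words_subspace]) (simp add: single_mem_free_words)

lemma insert_word_mem_free_words: "insert_word a w \<in> carrier (free_words (Suc (length w)))"
  by (induction w)
    (simp_all add: single_mem_free_words comb.subspace_diff[OF free_words_subspace]
      prepend_mem_free_words)

lemma alternating_word_mem_free_words: "alternating_word w \<in> carrier (free_words (length w))"
proof (induction w)
  case (Cons a w)
  show ?case
    using linear_extension_mem_subspace[OF free_words_subspace Cons] insert_word_mem_free_words
    by (metis alternating_word.simps(2) length_Cons)
qed (simp add: single_mem_free_words)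

lemma append_letter_prepend: "append_letter y (prepend x p) = prepend x (append_letter y p)"
  by (rule comb_linear_eqI[where p = p], (intro comb_linear_intros)+) simp

lemma insert_word_snoc:
  "insert_word a (w @ [y])
    = append_letter y (insert_word a w) + Poly_Mapping.single (w @ [y, a]) ((- 1) ^ Suc (length w))"
  by (induction w) (simp_all add: append_letter_prepend single_uminus)

text \<open>
  The cyclic face of \<open>x # w\<close> with its sign.
\<close>

definition last_mult_word :: "'a::ring \<Rightarrow> 'a list \<Rightarrow> ('a, 'k::field) comb" where
  "last_mult_word x w =
     (if w = [] then 0 else Poly_Mapping.single ((last w * x) # butlast w) ((- 1) ^ length w))"

abbreviation last_mult :: "'a::ring \<Rightarrow> ('a, 'k::field) comb \<Rightarrow> ('a, 'k) comb" where
  "last_mult x \<equiv> linear_extension (last_mult_word x)"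

lemma last_mult_append_letter:
  assumes "p \<in> carrier (free_words n)"
  shows "last_mult x (append_letter y p) = comb_scale ((- 1) ^ Suc n) (prepend (y * x) p)"
  by (rule comb_linear_eq_on_keys[where p = p],
      (intro comb_linear_intros)+)
    (use assms in \<open>simp add: last_mult_word_def mem_free_words_iff\<close>)

text \<open>
  The letter \<open>a\<close> becomes the last one, and is then multiplied with \<open>x\<close>, in exactly one of the
  insertions. All others take place behind the first letter of \<open>last_mult_word x w\<close>, which is
  expressed by the difference of \<open>insertion a\<close> and \<open>prepend a\<close>.
\<close>

lemma last_mult_insertion_word:
  "(last_mult x (insert_word a w) :: ('a::ring, 'k::field) comb)
    = insertion a (last_mult_word x w) - word ((a * x) # w) - prepend a (last_mult_word x w)"
proof (cases w rule: rev_cases)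
  case (snoc v y)
  have "(last_mult x (insert_word a w) :: ('a, 'k) comb)
      = comb_scale ((- 1) ^ length v) (prepend (y * x) (insert_word a v)) - word ((a * x) # w)"
    unfolding snoc insert_word_snoc
    by (simp add: last_mult_append_letter[OF insert_word_mem_free_words] last_mult_word_def
        single_uminus butlast_append flip: power_mult_distrib)
  moreover have "(last_mult_word x w :: ('a, 'k) comb) = comb_scale ((- 1) ^ Suc (length v)) (word ((y * x) # v))"
    by (simp add: last_mult_word_def snoc)
  ultimately show ?thesis
    by (simp del: comb_scale_single add: comb.scale_right_diff_distrib)
qed (simp add: last_mult_word_def single_uminus)

text \<open>
  The two faces of the Hochschild boundary of \<open>x # w\<close> that involve \<open>x\<close>.
\<close>

definition edge_mult :: "'a::ring \<Rightarrow> ('a, 'k::field) comb \<Rightarrow> ('a, 'k) comb" where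
  "edge_mult x p = head_mult x p + last_mult x p"

lemma edge_mult_insertion:
  "edge_mult x (insertion b p)
    = prepend (x * b) p - prepend (b * x) p
      + (insertion b (edge_mult x p) - prepend b (edge_mult x p))"
  unfolding edge_mult_def
  by (rule comb_linear_eqI[where p = p], (intro comb_linear_intros)+)
    (simp add: head_mult_insertion_word last_mult_insertion_word)

lemma bar_word_eq_sum:
  "bar_word w = (\<Sum>i < length w - 1. Poly_Mapping.single (face i w) ((- 1) ^ Suc i))"
proof (induction w)
  case (Cons x w)
  show ?case
  proof (cases w)
    case (Cons y v)
    have "(\<Sum>i < length (x # w) - 1. Poly_Mapping.single (face i (x # w)) ((- 1) ^ Suc i :: 'b))
        = - word ((x * y) # v)
          + (\<Sum>i < length v. Poly_Mapping.single (face (Suc i) (x # w)) ((- 1) ^ i))"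
      by (simp add: Cons sum.lessThan_Suc_shift face_def single_uminus del: sum.lessThan_Suc)
    also have "(\<Sum>i < length v. Poly_Mapping.single (face (Suc i) (x # w)) ((- 1) ^ i :: 'b))
        = - prepend x (\<Sum>i < length v. Poly_Mapping.single (face i w) ((- 1) ^ Suc i))"
      by (simp add: Cons face_def single_uminus sum_negf)
    finally show ?thesis
      using \<open>bar_word w = _\<close> by (simp add: Cons)
  qed simp
qed simp

lemma bar_word_mem_free_words: "bar_word w \<in> carrier (free_words (length w - 1))"
  unfolding bar_word_eq_sum
  by (auto intro!: comb.subspace_sum[OF free_words_subspace] single_mem_free_words simp: face_def)

lemma hochschild_word_Cons:
  assumes "w \<noteq> []"
  shows "(hochschild_word (x # w) :: ('a::ring, 'b::field) comb) = head_mult_word x w + last_mult_word x w + prepend x (bar_word w)"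
proof -
  obtain y v where w: "w = y # v" using assms by (cases w) auto
  have len: "length (x # w) = Suc (Suc (length v))" by (simp add: w)
  have split: "(\<Sum>i < Suc (Suc m). f i) = f 0 + (\<Sum>i < m. f (Suc i)) + f (Suc m)"
    for f :: "nat \<Rightarrow> ('a, 'b) comb" and m
    by (subst sum.lessThan_Suc) (simp only: sum.lessThan_Suc_shift)
  have "(hochschild_word (x # w) :: ('a, 'b) comb)
      = word ((x * y) # v)
        + (\<Sum>i < length v. Poly_Mapping.single (face (Suc i) (x # w)) ((- 1) ^ Suc i))
        + Poly_Mapping.single (face (Suc (length v)) (x # w)) ((- 1) ^ length w)"
    unfolding hochschild_word_def len split by (simp add: face_def w)
  also have "(\<Sum>i < length v. Poly_Mapping.single (face (Suc i) (x # w)) ((- 1) ^ Suc i :: 'b))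
      = prepend x (bar_word w)"
    unfolding bar_word_eq_sum by (simp add: w face_def)
  finally show ?thesis by (simp add: w last_mult_word_def face_def)
qed

lemma hochschild_prepend:
  assumes "p \<in> carrier (free_words (Suc n))"
  shows "linear_extension hochschild_word (prepend x p) = edge_mult x p + prepend x (bar p)"
  unfolding edge_mult_def
  by (rule comb_linear_eq_on_keys[where p = p], (intro comb_linear_intros)+)
    (use assms in \<open>force simp: mem_free_words_iff intro!: hochschild_word_Cons\<close>)

section \<open>Antisymmetrisation is a chain map\<close>

text \<open>
  The part of the Leibniz differential of \<open>a # w\<close> that brackets \<open>a\<close> with a later letter. The
  function \<open>g\<close> says what \<open>[a, b]\<close> in front of a word stands for, which is either the word with the
  letter \<open>bracket a b\<close> or a difference of two words.
\<close>

definition contract_word ::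
  "('a \<Rightarrow> 'a \<Rightarrow> 'a list \<Rightarrow> ('a, 'k::field) comb) \<Rightarrow> 'a \<Rightarrow> 'a list \<Rightarrow> ('a, 'k) comb" where
  "contract_word g a w =
     (\<Sum>j < length w. comb_scale ((- 1) ^ j) (g a (w ! j) (take j w @ drop (Suc j) w)))"

text \<open>
  The part of the sum with \<open>i = 0\<close> is split off; in the remaining part every index \<open>j\<close> of a
  removed letter is larger by one than in \<open>w\<close>, which accounts for the sign.
\<close>

fun leibniz_via :: 
  "('a \<Rightarrow> 'a \<Rightarrow> 'a list \<Rightarrow> ('a, 'k::field) comb) \<Rightarrow> 'a list \<Rightarrow> ('a, 'k) comb" where
  "leibniz_via g [] = 0"
| "leibniz_via g (a # w) = contract_word g a w - prepend a (leibniz_via g w)"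

definition commutator_word :: "'a::ring \<Rightarrow> 'a \<Rightarrow> 'a list \<Rightarrow> ('a, 'k::field) comb" where
  "commutator_word a b w = word ((a * b) # w) - word ((b * a) # w)"

lemma contract_word_Nil [simp]: "contract_word g a [] = 0"
  by (simp add: contract_word_def)

lemma contract_word_Cons:
  "contract_word g a (x # w) = g a x w - contract_word (\<lambda>a b v. g a b (x # v)) a w"
  by (simp add: contract_word_def sum.lessThan_Suc_shift sum_negf del: sum.lessThan_Suc)

lemma linear_contract_word:
  assumes "comb_linear F"
  shows "F (contract_word g a w) = contract_word (\<lambda>a b v. F (g a b v)) a w"
  by (simp add: contract_word_def module_hom.sum[OF assms] module_hom.scale[OF assms])

lemma contract_word_minus: "contract_word (\<lambda>a b v. - g a b v) a w = - contract_word g a w"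
  by (simp add: contract_word_def sum_negf)

lemma alternating_prepend:
  "linear_extension alternating_word (prepend a p) = insertion a (linear_extension alternating_word p)"
  by (rule comb_linear_eqI[where p = p], (intro comb_linear_intros)+) simp

text \<open>
  Both sides are the sum of the antisymmetrisations of \<open>w\<close> with one letter \<open>b\<close> replaced by \<open>[a, b]\<close>.
  On the left this letter stands in front, and the sign \<open>(-1)\<^sup>j\<close> moves it back to its place.
\<close>

lemma alternating_contract:
  "linear_extension alternating_word (contract_word commutator_word a w :: ('a::ring, 'k::field) comb) = ad a (alternating_word w)"
proof (induction w)
  case (Cons x w)
  have *: "linear_extension alternating_word (commutator_word a b (x # v) :: ('a, 'k) comb)
      = - insertion x (linear_extension alternating_word (commutator_word a b v))" for a b v
    by (simp add: commutator_word_def insertion_insertion[of x])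
  have "linear_extension alternating_word (contract_word (\<lambda>a b v. commutator_word a b (x # v)) a w :: ('a, 'k) comb)
      = - insertion x (linear_extension alternating_word (contract_word commutator_word a w))"
    by (simp add: linear_contract_word[OF linear_extension_linear] * contract_word_minus)
  then show ?case
    by (simp add: contract_word_Cons Cons ad_insertion)
      (simp add: commutator_word_def)
qed simp

text \<open>
  Induction on the word. The step combines \<open>alternating_contract\<close> with the formula \<open>bar_insertion\<close>,
  both of which produce \<open>ad a\<close>.
\<close>

lemma alternating_leibniz_via:
  "linear_extension alternating_word (leibniz_via commutator_word w) = - bar (alternating_word w)"
  by (induction w) (simp_all add: alternating_prepend alternating_contract bar_insertion)

text \<open>
  The map \<open>\<phi>\<close> on words in recursive form (\<open>antisym_word_eq\<close>).
\<close>

fun alternating_tail_word :: "'a list \<Rightarrow> ('a, 'k::field) comb" where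
  "alternating_tail_word [] = 0"
| "alternating_tail_word (a # w) = prepend a (alternating_word w)"

lemma alternating_tail_prepend:
  "linear_extension alternating_tail_word (prepend a p)
    = prepend a (linear_extension alternating_word p)"
  by (rule comb_linear_eqI[where p = p], (intro comb_linear_intros)+) simp

text \<open>
  In the antisymmetrisation of \<open>w\<close> each letter \<open>b\<close> occurs in the first and in the last place, with
  the same complementary words up to sign, so that the two faces that involve \<open>a\<close> combine to
  \<open>[a, b]\<close> in front of the antisymmetrisation of the other letters.
\<close>

lemma alternating_tail_contract:
  "linear_extension alternating_tail_word (contract_word commutator_word a w :: ('a::ring, 'k::field) comb)
    = edge_mult a (alternating_word w)"
proof (induction w)
  case (Cons x w)
  let ?F = "\<lambda>p :: ('a, 'k) comb. insertion x p - prepend x p"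
  have lin: "comb_linear ?F" by (intro comb_linear_intros)
  have *: "linear_extension alternating_tail_word (commutator_word a b (x # v) :: ('a, 'k) comb)
      = - ?F (linear_extension alternating_tail_word (commutator_word a b v))" for a b v
    by (simp add: commutator_word_def insertion_prepend)
  have "linear_extension alternating_tail_word (contract_word (\<lambda>a b v. commutator_word a b (x # v)) a w :: ('a, 'k) comb)
      = - ?F (linear_extension alternating_tail_word (contract_word commutator_word a w))"
    using linear_contract_word[OF lin, symmetric,
        of "\<lambda>a b v. linear_extension alternating_tail_word (commutator_word a b v)" a w]
    by (simp only: linear_contract_word[OF linear_extension_linear] * contract_word_minus)
  then show ?case
    by (simp add: contract_word_Cons Cons edge_mult_insertion)
      (simp add: commutator_word_def)
qed (simp add: edge_mult_def last_mult_word_def)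

text \<open>
  The map \<open>\<phi>\<close> commutes with the differentials when commutators are expanded. The brackets with the
  first letter give the two faces that involve it, and the other brackets give the inner faces.
\<close>

theorem alternating_tail_leibniz:
  assumes "length w \<ge> 2"
  shows "linear_extension alternating_tail_word
      (leibniz_via commutator_word w :: ('a::ring, 'k::field) comb)
    = linear_extension hochschild_word (alternating_tail_word w)"
proof -
  obtain a v n where w: "w = a # v" and "length v = Suc n" using assms by (cases w; cases "tl w") auto
  then have "(alternating_word v :: ('a, 'k) comb) \<in> carrier (free_words (Suc n))"
    using alternating_word_mem_free_words by metis
  then show ?thesis
    by (simp add: w hochschild_prepend alternating_tail_contract alternating_tail_prepend
        alternating_leibniz_via)
qed

section \<open>Antisymmetrisation as a sum over permutations\<close>

lemma insert_word_eq_sum: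
  "insert_word a w = (\<Sum>m \<le> length w. Poly_Mapping.single (take m w @ a # drop m w) ((- 1) ^ m))"
  by (induction w) (simp_all add: sum.atMost_Suc_shift sum_negf single_uminus del: sum.atMost_Suc)

text \<open>
  The cycle that moves \<open>k\<close> up to \<open>k + m\<close> and each of \<open>k + 1, \<dots>, k + m\<close> down by one.
\<close>

definition cycle_up :: "nat \<Rightarrow> nat \<Rightarrow> nat \<Rightarrow> nat" where
  "cycle_up k m x = (if x = k then k + m else if k < x \<and> x \<le> k + m then x - 1 else x)"

lemma cycle_up_0: "cycle_up k 0 = id"
  by (auto simp: cycle_up_def)

lemma cycle_up_Suc: "cycle_up k (Suc m) = transpose (k + m) (Suc (k + m)) \<circ> cycle_up k m"
  by (rule ext) (auto simp: cycle_up_def transpose_def)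

lemma cycle_up_permutes: "cycle_up k m permutes {k..k + m}"
proof (induction m)
  case (Suc m)
  show ?case
    unfolding cycle_up_Suc
    by (rule permutes_compose[OF permutes_subset[OF Suc] permutes_swap_id]) auto
qed (simp only: cycle_up_0 permutes_id)

lemma sign_cycle_up: "sign (cycle_up k m) = (- 1) ^ m"
proof (induction m)
  case (Suc m)
  have "permutation (cycle_up k m)"
    using cycle_up_permutes permutation_permutes by blast
  then show ?case
    unfolding cycle_up_Suc by (simp only: sign_compose permutation_swap_id sign_swap_id Suc) simp
qed (simp add: cycle_up_0 sign_id)

lemma inv_cycle_up:
  "inv_into UNIV (cycle_up k m) x = (if x = k + m then k else if k \<le> x \<and> x < k + m then Suc x else x)"
  by (rule inv_f_eq[OF permutes_inj[OF cycle_up_permutes]]) (auto simp: cycle_up_def)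

text \<open>
  A permutation is a permutation of the elements other than \<open>k\<close> followed by moving \<open>k\<close> to its
  place. The standard decomposition uses the transposition of \<open>k\<close> and \<open>k + m\<close> for the second step.
  The cycle differs from it by a permutation that fixes \<open>k\<close>, which is absorbed in the sum. Cycles
  are preferable because they act on words by insertion of one letter.
\<close>

lemma sum_permutations_insert_cycles:
  assumes "k < n"
  shows "(\<Sum>p | p permutes {k..<n}. f p)
    = (\<Sum>m \<le> n - Suc k. \<Sum>q | q permutes {Suc k..<n}. f (cycle_up k m \<circ> q))"
proof -
  have *: "(\<Sum>q | q permutes {Suc k..<n}. f (transpose k (k + m) \<circ> q))
      = (\<Sum>q | q permutes {Suc k..<n}. f (cycle_up k m \<circ> q))" if m: "m \<le> n - Suc k" for m
  proof -
    \<comment> \<open>the permutation fixing \<open>k\<close> by which cycle and transposition differ\<close>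
    let ?g = "transpose k (k + m) \<circ> cycle_up k m"
    have g_perm: "?g permutes {k..<n}"
      using m assms by (intro permutes_compose permutes_subset[OF cycle_up_permutes] permutes_swap_id) auto
    have g: "?g permutes {Suc k..<n}"
    proof (rule permutes_superset[OF g_perm])
      fix x assume "x \<in> {k..<n} - {Suc k..<n}"
      then have "x = k" by auto
      then show "?g x = x" by (simp add: cycle_up_def)
    qed
    have "transpose k (k + m) \<circ> (?g \<circ> q) = cycle_up k m \<circ> q" for q :: "nat \<Rightarrow> nat"
      by (simp add: fun_eq_iff)
    then show ?thesis
      by (subst setum_permutations_compose_left[OF g]) simp
  qed
  have ins: "{k..<n} = insert k {Suc k..<n}" using assms by auto
  have img: "{k..<n} = (\<lambda>m. k + m) ` {..n - Suc k}"
  proof (intro equalityI subsetI)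
    fix x assume "x \<in> {k..<n}"
    then show "x \<in> (\<lambda>m. k + m) ` {..n - Suc k}" by (intro image_eqI[of _ _ "x - k"]) auto
  qed (use assms in auto)
  have "(\<Sum>p | p permutes {k..<n}. f p)
      = (\<Sum>b\<in>{k..<n}. \<Sum>q | q permutes {Suc k..<n}. f (transpose k b \<circ> q))"
    unfolding ins by (rule sum_over_permutations_insert) auto
  also have "\<dots> = (\<Sum>m \<le> n - Suc k. \<Sum>q | q permutes {Suc k..<n}. f (transpose k (k + m) \<circ> q))"
    unfolding img by (subst sum.reindex) auto
  also have "\<dots> = (\<Sum>m \<le> n - Suc k. \<Sum>q | q permutes {Suc k..<n}. f (cycle_up k m \<circ> q))"
    by (rule sum.cong) (simp_all add: *)
  finally show ?thesis .
qed

lemma permuted_word_cycle_up: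
  assumes "k + m < length w" "q permutes {Suc k..<length w}"
  defines "v \<equiv> map (\<lambda>i. w ! inv_into UNIV q i) [Suc k..<length w]"
  shows "map (\<lambda>i. w ! inv_into UNIV (cycle_up k m \<circ> q) i) [k..<length w] = take m v @ w ! k # drop m v"
proof (rule nth_equalityI)
  show "length (map (\<lambda>i. w ! inv_into UNIV (cycle_up k m \<circ> q) i) [k..<length w])
    = length (take m v @ w ! k # drop m v)"
    using assms(1) by (auto simp: v_def)
next
  fix i assume "i < length (map (\<lambda>i. w ! inv_into UNIV (cycle_up k m \<circ> q) i) [k..<length w])"
  then have i: "k + i < length w" by simp
  have "inv_into UNIV (cycle_up k m \<circ> q) = inv_into UNIV q \<circ> inv_into UNIV (cycle_up k m)"
    using cycle_up_permutes assms(2) by (metis o_inv_distrib permutes_bij)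
  then have lhs: "map (\<lambda>i. w ! inv_into UNIV (cycle_up k m \<circ> q) i) [k..<length w] ! i
      = w ! inv_into UNIV q (inv_into UNIV (cycle_up k m) (k + i))"
    using i by (subst nth_map) (simp_all only: length_upt nth_upt[OF i] o_apply less_diff_conv add.commute)
  have fixed: "inv_into UNIV q k = k"
    using permutes_not_in[OF permutes_inv[OF assms(2)]] by simp
  have nth_v: "v ! j = w ! inv_into UNIV q (Suc k + j)" if "Suc k + j < length w" for j
    using that unfolding v_def
    by (subst nth_map) (simp_all only: length_upt nth_upt[OF that] less_diff_conv add.commute)
  have len: "length v = length w - Suc k" by (simp add: v_def)
  consider "i < m" | "i = m" | l where "i = Suc l" "m \<le> l"
    by (metis less_Suc_eq_le linorder_cases Suc_pred gr_implies_not0 neq0_conv)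
  then show "map (\<lambda>i. w ! inv_into UNIV (cycle_up k m \<circ> q) i) [k..<length w] ! i
    = (take m v @ w ! k # drop m v) ! i"
  proof cases
    case 3
    then have "(take m v @ w ! k # drop m v) ! i = v ! l"
      using i assms(1) len by (auto simp: nth_append min_def)
    then show ?thesis
      using 3 i nth_v[of l] unfolding lhs by (simp add: inv_cycle_up)
  next
    case 1
    then show ?thesis
      using assms(1) len nth_v[of i] unfolding lhs by (simp add: inv_cycle_up nth_append)
  next
    case 2
    then show ?thesis
      using assms(1) len unfolding lhs by (simp add: inv_cycle_up fixed nth_append)
  qed
qed

text \<open>
  Induction downwards on \<open>k\<close>: permuting positions from \<open>k\<close> on within the fixed word \<open>w\<close> makes all
  permutations act on the same index set, so no renumbering occurs in the step.
\<close>

lemma alternating_word_drop: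
  assumes "k \<le> length w"
  shows "(alternating_word (drop k w) :: ('a, 'k::field) comb)
    = (\<Sum>\<sigma> | \<sigma> permutes {k..<length w}.
        Poly_Mapping.single (map (\<lambda>i. w ! inv_into UNIV \<sigma> i) [k..<length w]) (of_int (sign \<sigma>)))"
  using assms
proof (induction k rule: inc_induct)
  case base
  then show ?case by (simp add: sign_id)
next
  case (step k)
  let ?n = "length w"
  let ?v = "\<lambda>q. map (\<lambda>i. w ! inv_into UNIV q i) [Suc k..<?n]"
  have eq: "Poly_Mapping.single (map (\<lambda>i. w ! inv_into UNIV (cycle_up k m \<circ> q) i) [k..<?n])
        (of_int (sign (cycle_up k m \<circ> q)))
      = comb_scale (of_int (sign q)) (Poly_Mapping.single (take m (?v q) @ w ! k # drop m (?v q)) ((- 1) ^ m))"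
    if "m \<le> ?n - Suc k" "q permutes {Suc k..<?n}" for m q
  proof -
    have "permutation (cycle_up k m)" "permutation q"
      using cycle_up_permutes that(2) permutation_permutes by blast+
    then show ?thesis
      using permuted_word_cycle_up[of k m w q] that step.hyps
      by (simp add: sign_compose sign_cycle_up mult.commute)
  qed
  have "(\<Sum>\<sigma> | \<sigma> permutes {k..<?n}.
        Poly_Mapping.single (map (\<lambda>i. w ! inv_into UNIV \<sigma> i) [k..<?n]) (of_int (sign \<sigma>) :: 'k))
     = (\<Sum>m \<le> ?n - Suc k. \<Sum>q | q permutes {Suc k..<?n}.
         comb_scale (of_int (sign q)) (Poly_Mapping.single (take m (?v q) @ w ! k # drop m (?v q)) ((- 1) ^ m)))"
    unfolding sum_permutations_insert_cycles[OF step.hyps(2)]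
    by (intro sum.cong refl eq) auto
  also have "\<dots> = (\<Sum>q | q permutes {Suc k..<?n}. comb_scale (of_int (sign q)) (insert_word (w ! k) (?v q)))"
    by (subst sum.swap) (simp add: insert_word_eq_sum comb.scale_sum_right)
  also have "\<dots> = insertion (w ! k) (alternating_word (drop (Suc k) w))"
    unfolding step.IH by simp
  also have "\<dots> = alternating_word (drop k w)"
    using Cons_nth_drop_Suc[OF step.hyps(2)] by (metis alternating_word.simps(2))
  finally show ?case by simp
qed

lemma antisym_word_eq: "w \<noteq> [] \<Longrightarrow> antisym_word w = alternating_tail_word w"
proof (cases w)
  case (Cons a v)
  have ivl: "{1..length w - 1} = {1..<length w}" by auto
  have "antisym_word w = prepend (w ! 0) (alternating_word (drop 1 w))"
    unfolding antisym_word_def ivl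
    by (subst alternating_word_drop) (use Cons in simp_all)
  then show ?thesis by (simp add: Cons)
qed simp

definition bracket_word :: "'a::ring \<Rightarrow> 'a \<Rightarrow> 'a list \<Rightarrow> ('a, 'k::field) comb" where
  "bracket_word a b w = word (bracket a b # w)"

lemma leibniz_word_eq: "leibniz_word w = leibniz_via bracket_word w"
proof (induction w)
  case (Cons a w)
  let ?P = "{(i, j). i < j \<and> j < length w}"
  let ?f = "\<lambda>w (i, j). Poly_Mapping.single
          (take i w @ bracket (w ! i) (w ! j) # drop (Suc i) (take j w) @ drop (Suc j) w)
          ((-1) ^ (j + 1)) :: ('a, 'b) comb"
  have fin: "finite ?P"
    by (rule finite_subset[of _ "{..<length w} \<times> {..<length w}"]) auto
  have "{(i, j). i < j \<and> j < length (a # w)}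
      = (\<lambda>j. (0, Suc j)) ` {..<length w} \<union> (\<lambda>(i, j). (Suc i, Suc j)) ` ?P"
    by (auto simp: image_iff less_Suc_eq_0_disj gr0_conv_Suc) 
  then have "leibniz_word (a # w)
      = sum (?f (a # w)) ((\<lambda>j. (0, Suc j)) ` {..<length w})
        + sum (?f (a # w)) ((\<lambda>(i, j). (Suc i, Suc j)) ` ?P)"
    unfolding leibniz_word_def using fin by (simp only:) (rule sum.union_disjoint, auto)
  also have "sum (?f (a # w)) ((\<lambda>j. (0, Suc j)) ` {..<length w}) = contract_word bracket_word a w"
    by (subst sum.reindex) (auto simp: inj_on_def contract_word_def bracket_word_def)
  also have "sum (?f (a # w)) ((\<lambda>(i, j). (Suc i, Suc j)) ` ?P) = - prepend a (sum (?f w) ?P)"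
    by (subst sum.reindex) (auto simp: inj_on_def single_uminus sum_negf[symmetric] intro!: sum.cong)
  also have "sum (?f w) ?P = leibniz_word w"
    by (simp add: leibniz_word_def)
  finally show ?case by (simp add: Cons)
qed (simp add: leibniz_word_def)

section \<open>Multilinearity\<close>

context assoc_algebra
begin

abbreviation rels :: "nat \<Rightarrow> ('a, 'k) comb set" where
  "rels n \<equiv> multilinear_relations scale n"

text \<open>
  Linearity of a function of one letter up to a subspace \<open>V\<close>.
\<close>

definition linear_mod :: "('a, 'k) comb set \<Rightarrow> ('a \<Rightarrow> ('a, 'k) comb) \<Rightarrow> bool" where
  "linear_mod V F \<longleftrightarrow> (\<forall>x y. F (x + y) - F x - F y \<in> V)
     \<and> (\<forall>c x. F (scale c x) - comb_scale c (F x) \<in> V)"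

lemma rels_subspace: "comb.subspace (rels n)"
  by (simp add: multilinear_relations_def)

lemma rels_subset_free_words: "rels n \<subseteq> carrier (free_words n)"
  unfolding multilinear_relations_def
  by (rule comb.span_minimal[OF _ free_words_subspace])
    (auto intro!: comb.subspace_diff[OF free_words_subspace] single_mem_free_words)

lemma linear_mod_word:
  assumes "length u + 1 + length v = n"
  shows "linear_mod (rels n) (\<lambda>x. word (u @ x # v))"
proof -
  have "word (u @ (x + y) # v) - word (u @ x # v) - word (u @ y # v) \<in> rels n" for x y
    unfolding multilinear_relations_def using assms by (intro comb.span_base) blast
  moreover have "word (u @ scale c x # v) - Poly_Mapping.single (u @ x # v) c \<in> rels n" for c x
    unfolding multilinear_relations_def using assms by (intro comb.span_base) blast
  ultimately show ?thesis by (simp add: linear_mod_def)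
qed

lemma linear_mod_compose:
  assumes "linear_mod V F" "\<And>x y. h (x + y) = h x + h y" "\<And>c x. h (scale c x) = scale c (h x)"
  shows "linear_mod V (\<lambda>x. F (h x))"
  using assms by (simp add: linear_mod_def)

lemma linear_mod_image:
  assumes "linear_mod V F" "comb_linear L" "\<And>p. p \<in> V \<Longrightarrow> L p \<in> V'"
  shows "linear_mod V' (\<lambda>x. L (F x))"
  using assms(1,3) unfolding linear_mod_def
  by (simp flip: module_hom.add[OF assms(2)] module_hom.diff[OF assms(2)] module_hom.scale[OF assms(2)])

lemma linear_mod_zero: "comb.subspace V \<Longrightarrow> linear_mod V (\<lambda>x. 0)"
  by (simp add: linear_mod_def comb.subspace_0)

lemma linear_mod_add:
  assumes "comb.subspace V" "linear_mod V F" "linear_mod V G"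
  shows "linear_mod V (\<lambda>x. F x + G x)"
  unfolding linear_mod_def
proof (intro conjI allI)
  fix x y c
  have "(F (x + y) - F x - F y) + (G (x + y) - G x - G y) \<in> V"
    using assms by (intro comb.subspace_add) (auto simp: linear_mod_def)
  then show "F (x + y) + G (x + y) - (F x + G x) - (F y + G y) \<in> V"
    by (simp add: algebra_simps)
  have "(F (scale c x) - comb_scale c (F x)) + (G (scale c x) - comb_scale c (G x)) \<in> V"
    using assms by (intro comb.subspace_add) (auto simp: linear_mod_def)
  then show "F (scale c x) + G (scale c x) - comb_scale c (F x + G x) \<in> V"
    by (simp add: algebra_simps comb.scale_right_distrib)
qed

lemma linear_mod_scale:
  assumes "comb.subspace V" "linear_mod V F"
  shows "linear_mod V (\<lambda>x. comb_scale c (F x))"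
  by (rule linear_mod_image[OF assms(2), of "comb_scale c"])
    (auto intro: comb_linear_intros comb.subspace_scale[OF assms(1)])

lemma linear_mod_minus:
  assumes "comb.subspace V" "linear_mod V F"
  shows "linear_mod V (\<lambda>x. - F x)"
  by (rule linear_mod_image[OF assms(2), of uminus])
    (auto intro: comb_linear_intros comb.subspace_neg[OF assms(1)])

lemma linear_mod_diff:
  assumes "comb.subspace V" "linear_mod V F" "linear_mod V G"
  shows "linear_mod V (\<lambda>x. F x - G x)"
  using linear_mod_add[OF assms(1,2) linear_mod_minus[OF assms(1,3)]] by simp

lemma linear_mod_sum:
  assumes "comb.subspace V" "\<And>i. i \<in> I \<Longrightarrow> linear_mod V (F i)"
  shows "linear_mod V (\<lambda>x. \<Sum>i\<in>I. F i x)"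
  using assms(2)
  by (induction I rule: infinite_finite_induct)
    (simp_all add: linear_mod_zero linear_mod_add assms(1))

lemma linear_mod_extension:
  assumes V: "comb.subspace V" and p: "p \<in> carrier (free_words n)"
    and f: "\<And>w. length w = n \<Longrightarrow> linear_mod V (\<lambda>x. f x w)"
  shows "linear_mod V (\<lambda>x. linear_extension (f x) p)"
  unfolding linear_mod_def
proof (intro conjI allI)
  fix x y c
  show "linear_extension (f (x + y)) p - linear_extension (f x) p - linear_extension (f y) p \<in> V"
    by (rule linear_map_in_subspace[where p = p], (intro comb_linear_intros)+, rule V)
      (use p f in \<open>simp add: mem_free_words_iff linear_mod_def\<close>)
  show "linear_extension (f (scale c x)) p - comb_scale c (linear_extension (f x) p) \<in> V"
    by (rule linear_map_in_subspace[where p = p], (intro comb_linear_intros)+, rule V)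
      (use p f in \<open>simp add: mem_free_words_iff linear_mod_def\<close>)
qed

lemma linear_mod_prepend:
  assumes "p \<in> carrier (free_words n)"
  shows "linear_mod (rels (Suc n)) (\<lambda>x. prepend x p)"
  unfolding prepend_def
  by (rule linear_mod_extension[OF rels_subspace assms]) (simp add: linear_mod_word[of "[]", simplified])

definition multilinear :: "nat \<Rightarrow> nat \<Rightarrow> ('a list \<Rightarrow> ('a, 'k) comb) \<Rightarrow> bool" where
  "multilinear n m f \<longleftrightarrow>
     (\<forall>u v. length u + 1 + length v = n \<longrightarrow> linear_mod (rels m) (\<lambda>x. f (u @ x # v)))"

text \<open>
  A map on words that is multilinear up to the relations descends to tensor powers.
\<close>

lemma multilinear_preserves_rels:
  assumes f: "multilinear n m f" and "p \<in> rels n"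
  shows "linear_extension f p \<in> rels m"
proof (rule span_linear_image[OF linear_extension_linear rels_subspace])
  show "p \<in> comb.span ({word (u @ (x + y) # v) - word (u @ x # v) - word (u @ y # v) | u x y v.
      length u + 1 + length v = n}
    \<union> {word (u @ scale c x # v) - Poly_Mapping.single (u @ x # v) c | u c x v.
      length u + 1 + length v = n})"
    using assms(2) by (simp add: multilinear_relations_def)
qed (use f in \<open>auto simp: multilinear_def linear_mod_def\<close>)

text \<open>
  Linearity in the first letter and multilinearity in the others are shown separately, following the
  recursive definitions of the word maps.
\<close>

lemma multilinear_Cons:
  assumes "\<And>x. multilinear n m (\<lambda>w. f (x # w))"
    and "\<And>w. length w = n \<Longrightarrow> linear_mod (rels m) (\<lambda>x. f (x # w))"
  shows "multilinear (Suc n) m f"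
  unfolding multilinear_def
proof (intro allI impI)
  fix u v :: "'a list" assume *: "length u + 1 + length v = Suc n"
  show "linear_mod (rels m) (\<lambda>x. f (u @ x # v))"
    using assms * by (cases u) (simp_all add: multilinear_def)
qed

lemma multilinear_zero: "multilinear 0 m f"
  by (simp add: multilinear_def)

lemma multilinear_add: "multilinear n m f \<Longrightarrow> multilinear n m g \<Longrightarrow> multilinear n m (\<lambda>w. f w + g w)"
  by (simp add: multilinear_def linear_mod_add[OF rels_subspace])

lemma multilinear_diff: "multilinear n m f \<Longrightarrow> multilinear n m g \<Longrightarrow> multilinear n m (\<lambda>w. f w - g w)"
  by (simp add: multilinear_def linear_mod_diff[OF rels_subspace])

lemma multilinear_minus: "multilinear n m f \<Longrightarrow> multilinear n m (\<lambda>w. - f w)"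
  by (simp add: multilinear_def linear_mod_minus[OF rels_subspace])

lemma multilinear_image:
  assumes "multilinear n m f" "comb_linear L" "\<And>p. p \<in> rels m \<Longrightarrow> L p \<in> rels m'"
  shows "multilinear n m' (\<lambda>w. L (f w))"
  unfolding multilinear_def
  by (intro allI impI linear_mod_image[OF _ assms(2,3)]) (use assms(1) in \<open>auto simp: multilinear_def\<close>)

lemma multilinear_cong:
  assumes "\<And>w. length w = n \<Longrightarrow> f w = g w"
  shows "multilinear n m f \<longleftrightarrow> multilinear n m g"
  using assms by (simp add: multilinear_def)

lemma multilinear_word: "multilinear n n word"
  by (simp add: multilinear_def linear_mod_word)

lemma multilinear_prefix: "length u + n = m \<Longrightarrow> multilinear n m (\<lambda>w. word (u @ w))"
  unfolding multilinear_def append_assoc[symmetric]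
  by (intro allI impI linear_mod_word) simp

lemma prepend_preserves_rels: "p \<in> rels n \<Longrightarrow> prepend x p \<in> rels (Suc n)"
  unfolding prepend_def
  by (rule multilinear_preserves_rels) (use multilinear_prefix[of "[x]"] in simp)

lemma multilinear_prepend: "multilinear n m f \<Longrightarrow> multilinear n (Suc m) (\<lambda>w. prepend x (f w))"
  by (erule multilinear_image[OF _ prepend_linear]) (rule prepend_preserves_rels)

lemma linear_mod_insert_word: "linear_mod (rels (Suc (length w))) (\<lambda>a. insert_word a w)"
proof (induction w)
  case Nil
  then show ?case using linear_mod_word[of "[]" "[]"] by simp
next
  case (Cons x w)
  show ?case
    using linear_mod_word[of "[]" "x # w"] linear_mod_image[OF Cons prepend_linear prepend_preserves_rels]
    by (simp add: linear_mod_diff[OF rels_subspace])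
qed

lemma multilinear_insert_word: "multilinear n (Suc n) (insert_word a)"
proof (induction n)
  case (Suc n)
  show ?case
  proof (rule multilinear_Cons)
    show "multilinear n (Suc (Suc n)) (\<lambda>w. insert_word a (x # w))" for x
      using multilinear_prefix[of "[a, x]" n] multilinear_prepend[OF Suc]
      by (simp add: multilinear_diff)
    show "linear_mod (rels (Suc (Suc n))) (\<lambda>x. insert_word a (x # w))" if "length w = n" for w
      using linear_mod_word[of "[a]" w] linear_mod_prepend[OF insert_word_mem_free_words, of w a] that
      by (simp add: linear_mod_diff[OF rels_subspace])
  qed
qed (rule multilinear_zero)

lemma multilinear_alternating_word: "multilinear n n alternating_word"
proof (induction n)
  case (Suc n)
  show ?case
  proof (rule multilinear_Cons)
    show "multilinear n (Suc n) (\<lambda>w. alternating_word (x # w))" for x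
      using multilinear_image[OF Suc linear_extension_linear
          multilinear_preserves_rels[OF multilinear_insert_word]]
      by simp
    show "linear_mod (rels (Suc n)) (\<lambda>x. alternating_word (x # w))" if "length w = n" for w
      unfolding alternating_word.simps
      by (rule linear_mod_extension[OF rels_subspace alternating_word_mem_free_words])
        (use linear_mod_insert_word that in auto)
  qed
qed (rule multilinear_zero)

lemma multilinear_alternating_tail_word: "multilinear (Suc n) (Suc n) alternating_tail_word"
proof (rule multilinear_Cons)
  show "multilinear n (Suc n) (\<lambda>w. alternating_tail_word (x # w))" for x
    using multilinear_prepend[OF multilinear_alternating_word] by simp
  show "linear_mod (rels (Suc n)) (\<lambda>x. alternating_tail_word (x # w))" if "length w = n" for w
    using linear_mod_prepend[OF alternating_word_mem_free_words] that by auto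
qed

lemma multilinear_antisym_word: "multilinear (Suc n) (Suc n) antisym_word"
  by (subst multilinear_cong[of _ _ alternating_tail_word])
    (auto intro: antisym_word_eq multilinear_alternating_tail_word)

lemma linear_mod_head_mult_word:
  assumes "length w = n"
  shows "linear_mod (rels n) (\<lambda>x. head_mult_word x w)"
proof (cases w)
  case (Cons y v)
  have "linear_mod (rels n) (\<lambda>x. word ([] @ (x * y) # v))"
    by (rule linear_mod_compose[OF linear_mod_word])
      (use assms in \<open>auto simp: Cons distrib_right scale_mult_left\<close>)
  then show ?thesis by (simp add: Cons)
qed (simp add: linear_mod_zero[OF rels_subspace])

lemma multilinear_head_mult_word: "multilinear n n (head_mult_word x)"
proof (cases n)
  case (Suc m)
  show ?thesis unfolding Suc
  proof (rule multilinear_Cons)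
    show "multilinear m (Suc m) (\<lambda>w. head_mult_word x (y # w))" for y
      using multilinear_prefix[of "[x * y]" m] by simp
    show "linear_mod (rels (Suc m)) (\<lambda>y. head_mult_word x (y # w))" if "length w = m" for w
      using linear_mod_compose[OF linear_mod_word[of "[]" w], of "Suc m" "(*) x"] that
      by (simp add: distrib_left scale_mult_right)
  qed
qed (simp add: multilinear_zero)

lemma linear_mod_last_mult_word:
  assumes "length w = n"
  shows "linear_mod (rels n) (\<lambda>x. last_mult_word x w)"
proof (cases w rule: rev_cases)
  case (snoc v y)
  have "linear_mod (rels n) (\<lambda>x. word ([] @ (y * x) # v))"
    by (rule linear_mod_compose[OF linear_mod_word])
      (use assms in \<open>auto simp: snoc distrib_left scale_mult_right\<close>)
  then have "linear_mod (rels n) (\<lambda>x. comb_scale ((- 1) ^ n) (word ([] @ (y * x) # v)))"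
    by (rule linear_mod_scale[OF rels_subspace])
  then show ?thesis using assms by (simp add: snoc last_mult_word_def)
qed (simp add: last_mult_word_def linear_mod_zero[OF rels_subspace])

lemma multilinear_last_mult_word: "multilinear n n (last_mult_word x)"
  unfolding multilinear_def
proof (intro allI impI)
  fix u v :: "'a list" assume n: "length u + 1 + length v = n"
  have "linear_mod (rels n) (\<lambda>y. word (if v = [] then [] @ (y * x) # u else ((last v * x) # u) @ y # butlast v))"
  proof (cases "v = []")
    case True
    then show ?thesis
      using linear_mod_compose[OF linear_mod_word[of "[]" u], of n "\<lambda>y. y * x"] n
      by (simp add: distrib_right scale_mult_left)
  next
    case False
    then have "length ((last v * x) # u) + 1 + length (butlast v) = n" using n by (cases v) auto
    from linear_mod_word[OF this] show ?thesis using False by simp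
  qed
  from linear_mod_scale[OF rels_subspace this, of "(- 1) ^ n"]
  show "linear_mod (rels n) (\<lambda>y. last_mult_word x (u @ y # v))"
    using n by (cases "v = []") (simp_all add: last_mult_word_def butlast_append)
qed

lemma multilinear_bar_word: "multilinear (Suc n) n bar_word"
proof (induction n)
  case 0
  then show ?case
    by (subst multilinear_cong[of _ _ "\<lambda>w. 0"])
      (auto simp: length_Suc_conv multilinear_def linear_mod_zero[OF rels_subspace])
next
  case (Suc n)
  show ?case
  proof (rule multilinear_Cons)
    show "multilinear (Suc n) (Suc n) (\<lambda>w. bar_word (x # w))" for x
      using multilinear_diff[OF multilinear_minus[OF multilinear_head_mult_word] multilinear_prepend[OF Suc]]
      by simp
    show "linear_mod (rels (Suc n)) (\<lambda>x. bar_word (x # w))" if "length w = Suc n" for w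
      using linear_mod_diff[OF rels_subspace
          linear_mod_minus[OF rels_subspace linear_mod_head_mult_word]
          linear_mod_prepend[OF bar_word_mem_free_words, of w]] that
      by simp
  qed
qed

lemma multilinear_hochschild_word: "multilinear (Suc (Suc n)) (Suc n) hochschild_word"
proof (rule multilinear_Cons)
  show "multilinear (Suc n) (Suc n) (\<lambda>w. hochschild_word (x # w))" for x
    by (subst multilinear_cong[of _ _
          "\<lambda>w. head_mult_word x w + last_mult_word x w + prepend x (bar_word w)"])
      (auto intro!: hochschild_word_Cons multilinear_add multilinear_head_mult_word
        multilinear_last_mult_word multilinear_prepend multilinear_bar_word)
  show "linear_mod (rels (Suc n)) (\<lambda>x. hochschild_word (x # w))" if w: "length w = Suc n" for w
  proof -
    have "w \<noteq> []" using w by auto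
    moreover have "linear_mod (rels (Suc n)) (\<lambda>x. prepend x (bar_word w))"
      using linear_mod_prepend[OF bar_word_mem_free_words, of w] w by simp
    ultimately show ?thesis
      using w by (simp add: hochschild_word_Cons linear_mod_add[OF rels_subspace]
          linear_mod_head_mult_word linear_mod_last_mult_word)
  qed
qed

lemma bracket_add_left: "bracket (x + y) b = bracket x b + bracket y b"
  and bracket_add_right: "bracket a (x + y) = bracket a x + bracket a y"
  and bracket_scale_left: "bracket (scale c x) b = scale c (bracket x b)"
  and bracket_scale_right: "bracket a (scale c x) = scale c (bracket a x)"
  by (simp_all add: bracket_def algebra_simps scale_mult_left scale_mult_right scale_right_diff_distrib)

lemma contract_bracket_mem_free_words:
  "(contract_word bracket_word a w :: ('a, 'k) comb) \<in> carrier (free_words (length w))"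
  unfolding contract_word_def bracket_word_def comb_scale_single
  by (auto intro!: comb.subspace_sum[OF free_words_subspace] single_mem_free_words)

lemma linear_mod_contract_bracket:
  "linear_mod (rels (length w)) (\<lambda>a. contract_word bracket_word a w)"
  unfolding contract_word_def
proof (intro linear_mod_sum linear_mod_scale rels_subspace)
  fix j assume "j \<in> {..<length w}"
  then show "linear_mod (rels (length w)) (\<lambda>a. bracket_word a (w ! j) (take j w @ drop (Suc j) w))"
    using linear_mod_compose[OF linear_mod_word[of "[]" "take j w @ drop (Suc j) w"],
        of "length w" "\<lambda>a. bracket a (w ! j)"]
    by (simp add: bracket_word_def bracket_add_left bracket_scale_left)
qed

lemma multilinear_contract_bracket: "multilinear n n (contract_word bracket_word a)"
  unfolding multilinear_def contract_word_def
proof (intro allI impI)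
  fix u v :: "'a list" assume n: "length u + 1 + length v = n"
  have "linear_mod (rels n)
      (\<lambda>x. bracket_word a ((u @ x # v) ! j) (take j (u @ x # v) @ drop (Suc j) (u @ x # v)))"
    if j: "j < n" for j
  proof -
    consider "j < length u" | "j = length u" | i where "j = Suc (length u + i)"
      by (metis less_iff_Suc_add linorder_cases)
    then show ?thesis
    proof cases
      case 1
      then show ?thesis
        using linear_mod_word[of "bracket a (u ! j) # take j u @ drop (Suc j) u" v n] n
        by (simp add: bracket_word_def nth_append)
    next
      case 2
      then show ?thesis
        using linear_mod_compose[OF linear_mod_word[of "[]" "u @ v"], of n "bracket a"] n
        by (simp add: bracket_word_def bracket_add_right bracket_scale_right)
    next
      case 3
      then show ?thesis
        using linear_mod_word[of "bracket a (v ! i) # u" "take i v @ drop (Suc i) v" n] n j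
        by (simp add: bracket_word_def nth_append)
    qed
  qed
  then show "linear_mod (rels n) (\<lambda>x. \<Sum>j<length (u @ x # v). comb_scale ((- 1) ^ j)
      (bracket_word a ((u @ x # v) ! j) (take j (u @ x # v) @ drop (Suc j) (u @ x # v))))"
    using n by (auto intro!: linear_mod_sum linear_mod_scale rels_subspace)
qed

lemma leibniz_bracket_mem_free_words:
  "(leibniz_via bracket_word w :: ('a, 'k) comb) \<in> carrier (free_words (length w - 1))"
proof (induction w)
  case (Cons a w)
  show ?case
  proof (cases "w = []")
    case True
    then show ?thesis by (simp add: comb.subspace_0[OF free_words_subspace])
  next
    case False
    then show ?thesis
      using prepend_mem_free_words[OF Cons.IH, of a] contract_bracket_mem_free_words[of a w]
      by (simp add: comb.subspace_diff[OF free_words_subspace])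
  qed
qed (simp add: comb.subspace_0[OF free_words_subspace])

lemma multilinear_leibniz_bracket: "multilinear (Suc n) n (leibniz_via bracket_word)"
proof (induction n)
  case 0
  then show ?case
    by (subst multilinear_cong[of _ _ "\<lambda>w. 0"])
      (auto simp: length_Suc_conv multilinear_def linear_mod_zero[OF rels_subspace])
next
  case (Suc n)
  show ?case
  proof (rule multilinear_Cons)
    show "multilinear (Suc n) (Suc n) (\<lambda>w. leibniz_via bracket_word (x # w))" for x
      using multilinear_diff[OF multilinear_contract_bracket multilinear_prepend[OF Suc]] by simp
    show "linear_mod (rels (Suc n)) (\<lambda>x. leibniz_via bracket_word (x # w))" if "length w = Suc n" for w
      using linear_mod_contract_bracket[of w]
        linear_mod_prepend[OF leibniz_bracket_mem_free_words, of w] that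
      by (simp add: linear_mod_diff[OF rels_subspace])
  qed
qed

lemma multilinear_leibniz_word: "multilinear (Suc n) n leibniz_word"
  unfolding multilinear_cong[OF leibniz_word_eq] by (rule multilinear_leibniz_bracket)

text \<open>
  Passing to tensor powers identifies the two readings of a bracket in front of a word.
\<close>

lemma commutator_cong_bracket:
  assumes "Suc (length w) = n"
  shows "bracket_word a b w - commutator_word a b w \<in> rels n"
proof -
  have lin: "linear_mod (rels n) (\<lambda>x. word ([] @ x # w))"
    by (rule linear_mod_word) (use assms in simp)
  have add: "word ((x + y) # w) - word (x # w) - word (y # w) \<in> rels n" for x y
    using lin by (simp add: linear_mod_def)
  have scl: "word (scale c x # w) - comb_scale c (word (x # w)) \<in> rels n" for c x
    using lin by (simp add: linear_mod_def)
  \<comment> \<open>the relations know sums and scalar multiples, so the difference is written with \<open>- 1\<close>\<close>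
  have "word ((a * b + scale (- 1) (b * a)) # w) - word (a * b # w) - word (scale (- 1) (b * a) # w)
      + (word (scale (- 1) (b * a) # w) - comb_scale (- 1) (word (b * a # w))) \<in> rels n"
    using add[of "a * b"] scl by (rule comb.subspace_add[OF rels_subspace])
  then show ?thesis
    by (simp add: bracket_word_def commutator_word_def bracket_def single_uminus algebra_simps)
qed

lemma contract_commutator_cong_bracket:
  "contract_word bracket_word a w - contract_word commutator_word a w \<in> rels (length w)"
  unfolding contract_word_def
  by (auto simp flip: sum_subtractf comb.scale_right_diff_distrib
      intro!: comb.subspace_sum[OF rels_subspace] comb.subspace_scale[OF rels_subspace]
        commutator_cong_bracket)

lemma leibniz_commutator_cong_bracket:
  "leibniz_via bracket_word w - leibniz_via commutator_word w \<in> rels (length w - 1)"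
proof (induction w)
  case (Cons a w)
  have "prepend a (leibniz_via bracket_word w - leibniz_via commutator_word w) \<in> rels (length w)"
  proof (cases "w = []")
    case True
    then show ?thesis by (simp add: comb.subspace_0[OF rels_subspace])
  next
    case False
    then show ?thesis using prepend_preserves_rels[OF Cons.IH, of a] by simp
  qed
  from comb.subspace_diff[OF rels_subspace contract_commutator_cong_bracket this]
  show ?case by (simp add: algebra_simps)
qed (simp add: comb.subspace_0[OF rels_subspace])

text \<open>
  The map \<open>\<phi>\<close> is a chain map.
\<close>

theorem antisym_leibniz_cong_hochschild_antisym:
  assumes "length w = Suc (Suc n)"
  shows "linear_extension antisym_word (leibniz_word w)
    - linear_extension hochschild_word (antisym_word w) \<in> rels (Suc n)"
proof -
  have antisym: "linear_extension antisym_word p = linear_extension alternating_tail_word p"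
    if "p \<in> carrier (free_words (Suc n))" for p :: "('a, 'k) comb"
    by (rule comb_linear_eq_on_keys[where p = p], (intro comb_linear_intros)+)
      (use that in \<open>force simp: mem_free_words_iff intro!: antisym_word_eq\<close>)
  have commute: "linear_extension alternating_tail_word
        (leibniz_via commutator_word w :: ('a, 'k) comb)
      = linear_extension hochschild_word (alternating_tail_word w)"
    using assms by (intro alternating_tail_leibniz) simp
  have "leibniz_word w - leibniz_via commutator_word w \<in> rels (Suc n)"
    using leibniz_commutator_cong_bracket[of w] assms by (simp add: leibniz_word_eq)
  from multilinear_preserves_rels[OF multilinear_alternating_tail_word this]
  have "linear_extension alternating_tail_word (leibniz_word w)
      - linear_extension hochschild_word (alternating_tail_word w) \<in> rels (Suc n)"
    using commute by simp
  moreover have "(leibniz_word w :: ('a, 'k) comb) \<in> carrier (free_words (Suc n))"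
    using leibniz_bracket_mem_free_words[of w] assms by (simp add: leibniz_word_eq)
  moreover have "w \<noteq> []" using assms by auto
  ultimately show ?thesis by (simp add: antisym antisym_word_eq)
qed

end

section \<open>Cyclic rotation\<close>

abbreviation one_minus_t_word :: "'a list \<Rightarrow> ('a, 'k::field) comb" where
  "one_minus_t_word w \<equiv> word w - cyclic_word w"

definition cyclic_image :: "nat \<Rightarrow> ('a, 'k::field) comb set" where
  "cyclic_image n = linear_extension one_minus_t_word ` carrier (free_words n)"

lemma cyclic_image_subspace: "comb.subspace (cyclic_image n)"
  unfolding cyclic_image_def
  by (rule module_hom.subspace_image[OF linear_extension_linear free_words_subspace])

lemma last_mult_word_snoc:
  "last_mult_word x (w @ [y]) = comb_scale ((- 1) ^ Suc (length w)) (word ((y * x) # w))"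
  by (simp add: last_mult_word_def)

text \<open>
  The recursion for the bar differential from the other end of the word.
\<close>

lemma bar_word_snoc2:
  "bar_word (w @ [z, y])
    = append_letter y (bar_word (w @ [z])) + Poly_Mapping.single (w @ [z * y]) ((- 1) ^ Suc (length w))"
proof (induction w)
  case (Cons x w)
  have "head_mult_word x (w @ [z, y]) = append_letter y (head_mult_word x (w @ [z]))"
    by (cases w) simp_all
  then show ?case
    by (simp add: Cons append_letter_prepend single_uminus)
qed (simp add: single_uminus)

lemma hochschild_word_eq_bar:
  assumes "length w \<ge> 2"
  shows "hochschild_word w = - bar_word w
    + Poly_Mapping.single ((last w * hd w) # tl (butlast w)) ((- 1) ^ (length w - 1))"
proof -
  obtain m where m: "length w = Suc m" using assms by (cases w) auto
  show ?thesis
    unfolding hochschild_word_def bar_word_eq_sum m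
    by (simp add: m face_def single_uminus sum_negf)
qed

lemma cyclic_append_letter:
  assumes "p \<in> carrier (free_words n)"
  shows "linear_extension cyclic_word (append_letter y p) = comb_scale ((- 1) ^ n) (prepend y p)"
  by (rule comb_linear_eq_on_keys[where p = p],
      (intro comb_linear_intros)+)
    (use assms in \<open>simp add: cyclic_word_def mem_free_words_iff\<close>)

text \<open>
  The classical identity \<open>b (1 - t) = (1 - t) b'\<close>, where \<open>b'\<close> omits the last face; here
  \<open>b' = - bar\<close>. It makes the cyclic complex a quotient complex of the Hochschild complex.
\<close>

lemma hochschild_one_minus_t_word:
  assumes "length w \<ge> 2"
  shows "linear_extension hochschild_word (one_minus_t_word w :: ('a::ring, 'k::field) comb)
    = linear_extension one_minus_t_word (- bar_word w)"
proof -
  obtain v y where w: "w = v @ [y]" using assms by (cases w rule: rev_cases) auto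
  obtain u z where v: "v = u @ [z]" using assms w by (cases v rule: rev_cases) auto
  let ?s = "(- 1) ^ length v :: 'k"
  have "v \<noteq> []" by (simp add: v)
  have split: "linear_extension one_minus_t_word p = p - linear_extension cyclic_word p"
    for p :: "('a, 'k) comb"
    by (rule comb_linear_eqI[where p = p], (intro comb_linear_intros)+) simp
  have head: "word ((y * hd v) # tl v) = (head_mult_word y v :: ('a, 'k) comb)"
    using \<open>v \<noteq> []\<close> by (cases v) simp_all
  have "(hochschild_word w :: ('a, 'k) comb) = - bar_word w + comb_scale ?s (head_mult_word y v)"
    using hochschild_word_eq_bar[OF assms] \<open>v \<noteq> []\<close> by (simp add: w butlast_append flip: head)
  moreover have "linear_extension hochschild_word (cyclic_word w :: ('a, 'k) comb)
      = comb_scale ?s (head_mult_word y v + last_mult_word y v + prepend y (bar_word v))"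
    using \<open>v \<noteq> []\<close> by (simp add: cyclic_word_def w hochschild_word_Cons)
  moreover have "linear_extension cyclic_word (bar_word w)
      = - comb_scale ?s (last_mult_word y v + prepend y (bar_word v) :: ('a, 'k) comb)"
  proof -
    have "(bar_word v :: ('a, 'k) comb) \<in> carrier (free_words (length u))"
      using bar_word_mem_free_words[of v] by (simp add: v)
    then have "linear_extension cyclic_word (append_letter y (bar_word v))
        = - comb_scale ?s (prepend y (bar_word v) :: ('a, 'k) comb)"
      by (simp add: cyclic_append_letter v)
    then show ?thesis
      by (simp add: w v bar_word_snoc2 last_mult_word_snoc cyclic_word_def single_uminus
          comb.scale_right_distrib comb.scale_right_diff_distrib)
  qed
  ultimately show ?thesis
    by (simp add: split comb.scale_right_distrib algebra_simps)
qed

lemma hochschild_cyclic_image: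
  assumes "p \<in> cyclic_image (Suc (Suc n))"
  shows "linear_extension hochschild_word p \<in> (cyclic_image (Suc n) :: ('a::ring, 'k::field) comb set)"
proof -
  obtain q where q: "q \<in> carrier (free_words (Suc (Suc n)))"
    and p: "p = linear_extension one_minus_t_word q"
    using assms by (auto simp: cyclic_image_def)
  have "linear_extension hochschild_word (linear_extension one_minus_t_word q)
      = linear_extension one_minus_t_word (- bar q)"
    by (rule comb_linear_eq_on_keys[where p = q], (intro comb_linear_intros)+)
      (use q in \<open>simp add: mem_free_words_iff hochschild_one_minus_t_word[simplified]\<close>)
  moreover have "bar q \<in> carrier (free_words (Suc n))"
    by (rule linear_extension_mem_subspace[OF free_words_subspace q])
      (metis bar_word_mem_free_words diff_Suc_1)
  ultimately show ?thesis
    unfolding p cyclic_image_def using comb.subspace_neg[OF free_words_subspace] by blast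
qed

text \<open>
  Moving one letter from the front to the end is the inverse of \<open>t\<close>, and it is done
  \<open>length x\<close> times.
\<close>

lemma rotate_cyclic_image:
  "word (x @ y) - comb_scale ((- 1) ^ (length x * (length x + length y - 1))) (word (y @ x))
    \<in> cyclic_image (length x + length y)"
proof (induction x arbitrary: y)
  case Nil
  then show ?case by (simp add: comb.subspace_0[OF cyclic_image_subspace])
next
  case (Cons z x)
  let ?n = "length x + length y"
  have "one_minus_t_word (x @ y @ [z]) \<in> (cyclic_image (Suc ?n) :: ('a, 'b) comb set)"
    unfolding cyclic_image_def
    by (rule image_eqI[of _ _ "word (x @ y @ [z])"]) (simp_all add: single_mem_free_words)
  then have "comb_scale (- ((- 1) ^ ?n)) (one_minus_t_word (x @ y @ [z])) \<in> (cyclic_image (Suc ?n) :: ('a, 'b) comb set)"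
    by (rule comb.subspace_scale[OF cyclic_image_subspace])
  moreover have "comb_scale (- ((- 1) ^ ?n)) (one_minus_t_word (x @ y @ [z]))
      = (word (z # x @ y) - comb_scale ((- 1) ^ ?n) (word (x @ y @ [z])) :: ('a, 'b) comb)"
    by (simp add: cyclic_word_def comb.scale_right_diff_distrib butlast_append single_uminus
        flip: power_mult_distrib)
  moreover have "comb_scale ((- 1) ^ ?n) (word (x @ y @ [z])
        - comb_scale ((- 1) ^ (length x * ?n)) (word ((y @ [z]) @ x))) \<in> (cyclic_image (Suc ?n) :: ('a, 'b) comb set)"
    using Cons[of "y @ [z]"] by (intro comb.subspace_scale[OF cyclic_image_subspace]) simp
  ultimately have "(word (z # x @ y) - comb_scale ((- 1) ^ ?n) (word (x @ y @ [z])))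
     + comb_scale ((- 1) ^ ?n) (word (x @ y @ [z])
        - comb_scale ((- 1) ^ (length x * ?n)) (word ((y @ [z]) @ x))) \<in> (cyclic_image (Suc ?n) :: ('a, 'b) comb set)"
    by (metis comb.subspace_add[OF cyclic_image_subspace])
  then show ?case
    by (simp add: comb.scale_right_diff_distrib power_add)
qed

text \<open>
  The signed rotation \<open>t\<^sup>-\<^sup>1\<close>, which takes the first letter to the end and so fits recursion on
  words.
\<close>

definition rotation_word :: "'a list \<Rightarrow> ('a, 'k::field) comb" where
  "rotation_word w = Poly_Mapping.single (rotate1 w) ((- 1) ^ (length w - 1))"

abbreviation rotation :: "('a, 'k::field) comb \<Rightarrow> ('a, 'k) comb" where
  "rotation \<equiv> linear_extension rotation_word"

lemma rotation_prepend:
  assumes "p \<in> carrier (free_words n)"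
  shows "rotation (prepend x p) = comb_scale ((- 1) ^ n) (append_letter x p)"
  by (rule comb_linear_eq_on_keys[where p = p],
      (intro comb_linear_intros)+)
    (use assms in \<open>simp add: rotation_word_def mem_free_words_iff\<close>)

text \<open>
  Rotation turns the insertions of \<open>b\<close> into \<open>w\<close> into insertions into the rotated word, with the
  exception of the insertions in front and at the end, which occupy the same gap when the word is
  written on a circle. These produce the right-hand side.
\<close>

lemma rotation_insert_word:
  "rotation (insert_word b w) - insertion b (rotation_word w)
    = comb_scale ((- 1) ^ length w) (append_letter b (word w - rotation_word w))"
proof (cases w)
  case (Cons y v)
  then show ?thesis
    by (simp add: rotation_prepend[OF insert_word_mem_free_words] rotation_word_def insert_word_snoc
        comb.scale_right_distrib comb.scale_right_diff_distrib single_uminus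
        flip: power_mult_distrib power_add)
qed (simp add: rotation_word_def)

lemma rotation_insertion:
  assumes "p \<in> carrier (free_words n)"
  shows "rotation (insertion b p) - insertion b (rotation p)
    = comb_scale ((- 1) ^ n) (append_letter b (p - rotation p))"
  by (rule comb_linear_eq_on_keys[where p = p],
      (intro comb_linear_intros)+)
    (use assms in \<open>simp add: mem_free_words_iff rotation_insert_word\<close>)

text \<open>
  A cyclic permutation of the positions multiplies the antisymmetriser by the sign of the cycle,
  and \<open>rotation\<close> contains the same sign. In the induction the error term of \<open>rotation_insertion\<close>
  vanishes by the induction hypothesis.
\<close>

lemma rotation_alternating_word:
  "rotation (alternating_word w) = (alternating_word w :: ('a, 'k::field) comb)"
proof (induction w)
  case (Cons a w)
  have "(alternating_word w :: ('a, 'k) comb) \<in> carrier (free_words (length w))"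
    by (rule alternating_word_mem_free_words)
  from rotation_insertion[OF this, of a]
  have "rotation (insertion a (alternating_word w))
      = insertion a (rotation (alternating_word w) :: ('a, 'k) comb)"
    by (simp add: Cons)
  then show ?case by (simp add: Cons)
qed (simp add: rotation_word_def)

lemma rotation_funpow_word:
  "(rotation ^^ i) (word w) = Poly_Mapping.single (rotate i w) ((- 1) ^ (i * (length w - 1)))"
  by (induction i) (simp_all add: rotation_word_def rotate_Suc power_add mult.commute)

lemma comb_linear_funpow:
  fixes f :: "'a list \<Rightarrow> ('a, 'k::field) comb"
  shows "comb_linear (\<lambda>p. (linear_extension f ^^ i) p)"
proof (induction i)
  case (Suc i)
  from comb_linear_extension[OF this] show ?case by (simp add: comp_def)
qed (simp add: comb_linear_id)

text \<open>
  Modulo the image of \<open>1 - t\<close> each insertion can be rotated so that \<open>a\<close> comes first, which rotates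
  the remaining letters.
\<close>

lemma insert_word_cong_rotations:
  "insert_word a w - (\<Sum>i\<le>length w. prepend a ((rotation ^^ i) (word w)))
    \<in> cyclic_image (Suc (length w))"
proof -
  let ?n = "length w"
  have "Poly_Mapping.single (take i w @ a # drop i w) ((- 1) ^ i) - prepend a ((rotation ^^ i) (word w))
      \<in> (cyclic_image (Suc ?n) :: ('a, 'b) comb set)" if "i \<le> ?n" for i
  proof -
    have "word (take i w @ (a # drop i w)) - comb_scale
          ((- 1) ^ (length (take i w) * (length (take i w) + length (a # drop i w) - 1)))
          (word ((a # drop i w) @ take i w))
        \<in> (cyclic_image (length (take i w) + length (a # drop i w)) :: ('a, 'b) comb set)"
      by (rule rotate_cyclic_image)
    moreover have "length (take i w) = i" "length (take i w) + length (a # drop i w) = Suc ?n"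
      using that by simp_all
    ultimately have "word (take i w @ (a # drop i w))
        - comb_scale ((- 1) ^ (i * ?n)) (word ((a # drop i w) @ take i w)) \<in> (cyclic_image (Suc ?n) :: ('a, 'b) comb set)"
      by (simp only: diff_Suc_1)
    then have "comb_scale ((- 1) ^ i) (word (take i w @ (a # drop i w))
        - comb_scale ((- 1) ^ (i * ?n)) (word ((a # drop i w) @ take i w))) \<in> (cyclic_image (Suc ?n) :: ('a, 'b) comb set)"
      by (rule comb.subspace_scale[OF cyclic_image_subspace])
    moreover have "rotate i w = drop i w @ take i w"
      using that by (cases "i = ?n") (simp_all add: rotate_drop_take)
    moreover have "(- 1) ^ i * (- 1) ^ (i * ?n) = ((- 1) ^ (i * (?n - 1)) :: 'b)"
      using that by (cases ?n) (simp_all add: power_add)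
    ultimately show ?thesis
      by (simp add: rotation_funpow_word comb.scale_right_diff_distrib)
  qed
  then show ?thesis
    unfolding insert_word_eq_sum sum_subtractf[symmetric]
    by (intro comb.subspace_sum[OF cyclic_image_subspace]) auto
qed

lemma insertion_cong_rotations:
  assumes "p \<in> carrier (free_words n)"
  shows "insertion a p - (\<Sum>i\<le>n. prepend a ((rotation ^^ i) p)) \<in> cyclic_image (Suc n)"
  by (rule linear_map_in_subspace[where p = p],
      (intro comb_linear_intros comb_linear_funpow)+, rule cyclic_image_subspace)
    (use assms insert_word_cong_rotations in \<open>fastforce simp: mem_free_words_iff\<close>)

text \<open>
  The full antisymmetriser of \<open>n + 1\<close> letters is a sum over the positions of the first letter.
  Modulo rotation all \<open>n + 1\<close> of them contribute equally, because the antisymmetrised tail is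
  invariant under \<open>rotation\<close>.
\<close>

lemma alternating_word_cong_tail:
  "alternating_word (a # w) - comb_scale (of_nat (Suc (length w))) (alternating_tail_word (a # w))
    \<in> (cyclic_image (Suc (length w)) :: ('a, 'b::field) comb set)"
proof -
  have mem: "(alternating_word w :: ('a, 'b) comb) \<in> carrier (free_words (length w))"
    by (rule alternating_word_mem_free_words)
  have "(rotation ^^ i) (alternating_word w) = (alternating_word w :: ('a, 'b) comb)" for i
    by (induction i) (simp_all add: rotation_alternating_word)
  moreover have "(\<Sum>i\<le>n. p) = comb_scale (of_nat (Suc n)) p" for n and p :: "('a, 'b) comb"
    by (simp add: comb.sum_constant_scale)
  ultimately show ?thesis
    using insertion_cong_rotations[OF mem, of a] by simp
qed

text \<open>
  The insertion of \<open>x\<close> anticommutes past the others until it meets another insertion of \<open>x\<close>,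
  and its square is its own negative.
\<close>

lemma insertion_alternating_word_eq_0:
  fixes w :: "'a list"
  assumes "x \<in> set w"
  shows "insertion x (alternating_word w) = (0 :: ('a, 'k::field_char_0) comb)"
  using assms
proof (induction w)
  case (Cons y w)
  show ?case
  proof (cases "x = y")
    case True
    let ?q = "insertion x (insertion x (alternating_word w)) :: ('a, 'k) comb"
    have "?q + ?q = 0" using insertion_insertion[of x x "alternating_word w"] by (metis add.left_inverse)
    then have "comb_scale 2 ?q = 0"
      by (metis comb.scale_left_distrib comb.scale_one one_add_one)
    then show ?thesis using True by simp
  next
    case False
    then show ?thesis using Cons by (simp add: insertion_insertion[of x y])
  qed
qed simp

lemma alternating_word_not_distinct:
  "\<not> distinct w \<Longrightarrow> alternating_word w = (0 :: ('a, 'k::field_char_0) comb)"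
  by (induction w) (auto simp: insertion_alternating_word_eq_0)

text \<open>
  This is what makes \<open>\<theta>\<close> well defined on exterior powers. If the repeated letters are not the
  first one, then \<open>\<phi>\<close> already vanishes. In general \<open>n + 1\<close> times \<open>\<phi>\<close> agrees with the full
  antisymmetriser, which vanishes, and \<open>n + 1\<close> is invertible in characteristic zero.
\<close>

lemma antisym_word_not_distinct:
  assumes "\<not> distinct w"
  shows "antisym_word w \<in> (cyclic_image (length w) :: ('a, 'k::field_char_0) comb set)"
proof -
  obtain a v where w: "w = a # v" using assms by (cases w) auto
  let ?c = "of_nat (Suc (length v)) :: 'k"
  have "alternating_word w = (0 :: ('a, 'k) comb)"
    by (rule alternating_word_not_distinct[OF assms])
  moreover have "(alternating_word w - comb_scale ?c (alternating_tail_word w) :: ('a, 'k) comb)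
      \<in> cyclic_image (length w)"
    unfolding w list.size add_0_right add_Suc_right by (rule alternating_word_cong_tail)
  ultimately have "0 - comb_scale ?c (antisym_word w) \<in> cyclic_image (length w)"
    by (simp only: antisym_word_eq w list.distinct not_False_eq_True)
  then have "comb_scale (- inverse ?c) (0 - comb_scale ?c (antisym_word w)) \<in> cyclic_image (length w)"
    by (rule comb.subspace_scale[OF cyclic_image_subspace])
  then show ?thesis by (simp del: of_nat_Suc)
qed

section \<open>Repeated letters and the Leibniz differential\<close>

text \<open>
  The letter \<open>x\<close> that comes before \<open>w\<close> ends up behind the bracket when \<open>a\<close> is bracketed with a
  letter of \<open>w\<close>.
\<close>

fun insert_second_word :: "'a \<Rightarrow> 'a list \<Rightarrow> ('a, 'k::field) comb" where
  "insert_second_word x [] = 0"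
| "insert_second_word x (z # w) = word (z # x # w)"

abbreviation insert_second :: "'a \<Rightarrow> ('a, 'k::field) comb \<Rightarrow> ('a, 'k) comb" where
  "insert_second x \<equiv> linear_extension (insert_second_word x)"

lemma contract_bracket_Cons:
  "contract_word bracket_word a (x # w)
    = word (bracket a x # w) - insert_second x (contract_word bracket_word a w)"
  by (simp add: contract_word_Cons linear_contract_word[OF linear_extension_linear] bracket_word_def)

context assoc_algebra
begin

definition repeated :: "nat \<Rightarrow> ('a, 'k) comb set" where
  "repeated n = comb.span {word w | w. length w = n \<and> \<not> distinct w}"

text \<open>
  The kernel of the projection from combinations of words of length \<open>n\<close> to the exterior power.
\<close>

definition alternating_rels :: "nat \<Rightarrow> ('a, 'k) comb set" where
  "alternating_rels n = comb.span (rels n \<union> repeated n)"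

lemma alternating_rels_subspace: "comb.subspace (alternating_rels n)"
  by (simp add: alternating_rels_def)

lemma rels_in_alternating_rels: "p \<in> rels n \<Longrightarrow> p \<in> alternating_rels n"
  by (simp add: alternating_rels_def comb.span_base)

lemma repeated_in_alternating_rels:
  "length w = n \<Longrightarrow> \<not> distinct w \<Longrightarrow> word w \<in> alternating_rels n"
  unfolding alternating_rels_def repeated_def by (blast intro: comb.span_base)

lemma linear_map_alternating_rels:
  assumes "comb_linear F" "comb.subspace V" "p \<in> alternating_rels n"
    and "\<And>p. p \<in> rels n \<Longrightarrow> F p \<in> V"
    and "\<And>w. length w = n \<Longrightarrow> \<not> distinct w \<Longrightarrow> F (word w) \<in> V"
  shows "F p \<in> V"
proof (rule span_linear_image[OF assms(1,2) _ assms(3)[unfolded alternating_rels_def]])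
  fix q assume "q \<in> rels n \<union> repeated n"
  then show "F q \<in> V"
  proof
    assume "q \<in> repeated n"
    then show ?thesis
      unfolding repeated_def by (rule span_linear_image[OF assms(1,2), rotated]) (use assms(5) in auto)
  qed (rule assms(4))
qed

lemma prepend_alternating_rels:
  "p \<in> alternating_rels n \<Longrightarrow> prepend x p \<in> alternating_rels (Suc n)"
  by (erule linear_map_alternating_rels[OF prepend_linear alternating_rels_subspace])
    (auto intro: prepend_preserves_rels rels_in_alternating_rels repeated_in_alternating_rels)

lemma multilinear_insert_second_word: "multilinear n (Suc n) (insert_second_word x)"
proof (cases n)
  case (Suc m)
  show ?thesis unfolding Suc
  proof (rule multilinear_Cons)
    show "multilinear m (Suc (Suc m)) (\<lambda>w. insert_second_word x (z # w))" for z
      using multilinear_prefix[of "[z, x]" m] by simp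
    show "linear_mod (rels (Suc (Suc m))) (\<lambda>z. insert_second_word x (z # w))" if "length w = m" for w
      using linear_mod_word[of "[]" "x # w" "Suc (Suc m)"] that by simp
  qed
qed (simp add: multilinear_zero)

lemma insert_second_alternating_rels:
  assumes "p \<in> alternating_rels n"
  shows "insert_second x p \<in> alternating_rels (Suc n)"
proof (rule linear_map_alternating_rels[OF linear_extension_linear alternating_rels_subspace assms])
  show "insert_second x p \<in> alternating_rels (Suc n)" if "p \<in> rels n" for p
    using that by (intro rels_in_alternating_rels multilinear_preserves_rels[OF multilinear_insert_second_word])
  show "insert_second x (word w) \<in> alternating_rels (Suc n)"
    if "length w = n" "\<not> distinct w" for w
    using that by (cases w) (auto intro!: repeated_in_alternating_rels)
qed

text \<open>
  Polarisation of the words in which the two neighbouring letters are equal.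
\<close>

lemma swap_in_subspace:
  assumes "comb.subspace V" "rels n \<subseteq> V" "\<And>z. word (u @ z # z # v) \<in> V"
    and "length u + length v + 2 = n"
  shows "word (u @ x # y # v) + word (u @ y # x # v) \<in> V"
proof -
  have L: "word (u @ (x + y) # z # v) - word (u @ x # z # v) - word (u @ y # z # v) \<in> V" for z
    using linear_mod_word[of u "z # v" n] assms(2,4) by (auto simp: linear_mod_def)
  have R: "word (u @ z # (x + y) # v) - word (u @ z # x # v) - word (u @ z # y # v) \<in> V" for z
    using linear_mod_word[of "u @ [z]" v n] assms(2,4) by (auto simp: linear_mod_def)
  \<comment> \<open>the word with \<open>x + y\<close> twice, expanded in both places, minus its two diagonal terms\<close>
  have "word (u @ (x + y) # (x + y) # v) - (word (u @ (x + y) # (x + y) # v)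
        - word (u @ x # (x + y) # v) - word (u @ y # (x + y) # v))
      - (word (u @ x # (x + y) # v) - word (u @ x # x # v) - word (u @ x # y # v))
      - (word (u @ y # (x + y) # v) - word (u @ y # x # v) - word (u @ y # y # v))
      - word (u @ x # x # v) - word (u @ y # y # v) \<in> V"
    by (intro comb.subspace_diff[OF assms(1)] assms(3) L R)
  then show ?thesis by (simp add: algebra_simps)
qed

lemma swap_in_alternating_rels:
  assumes "length u + length v + 2 = n"
  shows "word (u @ x # y # v) + word (u @ y # x # v) \<in> alternating_rels n"
  by (rule swap_in_subspace[OF alternating_rels_subspace _ _ assms])
    (use assms in \<open>auto intro: rels_in_alternating_rels repeated_in_alternating_rels\<close>)

text \<open>
  If \<open>a\<close> is bracketed with a letter outside the pair \<open>x x\<close>, the pair survives. The brackets with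
  the two letters \<open>x\<close> give the same word with opposite signs.
\<close>

lemma contract_bracket_adjacent:
  "contract_word bracket_word a (u @ x # x # v) \<in> alternating_rels (length u + length v + 2)"
proof (induction u)
  case Nil
  have "insert_second x (insert_second x (contract_word bracket_word a v))
      \<in> alternating_rels (Suc (Suc (length v)))"
  proof (rule linear_map_in_subspace[where p = "contract_word bracket_word a v",
        OF _ alternating_rels_subspace])
    fix w assume "w \<in> Poly_Mapping.keys (contract_word bracket_word a v :: ('a, 'k) comb)"
    then have "length w = length v"
      using contract_bracket_mem_free_words by (auto simp: mem_free_words_iff)
    then show "insert_second x (insert_second x (word w)) \<in> alternating_rels (Suc (Suc (length v)))"
      by (cases w) (auto intro!: repeated_in_alternating_rels comb.subspace_0[OF alternating_rels_subspace])
  qed (intro comb_linear_intros)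
  then show ?case by (simp add: contract_bracket_Cons)
next
  case (Cons z u)
  have "word (bracket a z # u @ x # x # v) \<in> alternating_rels (Suc (length u + length v + 2))"
    by (rule repeated_in_alternating_rels) auto
  from comb.subspace_diff[OF alternating_rels_subspace this insert_second_alternating_rels[OF Cons, of z]]
  show ?case by (simp add: contract_bracket_Cons)
qed

text \<open>
  The differential maps a word with two equal neighbours to the alternating relations. By recursion
  it remains to treat brackets with one of the two letters \<open>x\<close> on the left: \<open>[x, x] = 0\<close>, and the
  brackets of the two letters \<open>x\<close> with the same later letter differ by a swap of neighbours.
\<close>

lemma leibniz_adjacent:
  "leibniz_via bracket_word (u @ x # x # v) \<in> alternating_rels (length u + length v + 1)"
proof (induction u)
  case Nil
  have "linear_mod (rels (Suc (length v))) (\<lambda>y. word ([] @ y # v))"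
    by (rule linear_mod_word) simp
  \<comment> \<open>a word with a letter \<open>0\<close> is a relation, because \<open>0 + 0 = 0\<close>\<close>
  from linear_mod_compose[OF this, of "\<lambda>y. y"]
  have "word ((0 + 0) # v) - word (0 # v) - word (0 # v) \<in> rels (Suc (length v))"
    unfolding linear_mod_def by (metis append_Nil)
  then have "- word (0 # v) \<in> rels (Suc (length v))" by simp
  then have zero: "word (bracket x x # v) \<in> alternating_rels (Suc (length v))"
    using comb.subspace_neg[OF rels_subspace]
    by (metis add.inverse_inverse bracket_def diff_self rels_in_alternating_rels)
  show ?case
  proof (cases "v = []")
    case True
    then show ?thesis using zero by (simp add: bracket_word_def contract_word_Cons)
  next
    case False
    let ?E = "contract_word bracket_word x v :: ('a, 'k) comb"
    have E: "length w = length v" if "w \<in> Poly_Mapping.keys ?E" for w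
      using that contract_bracket_mem_free_words by (auto simp: mem_free_words_iff)
    have swap: "insert_second x ?E + prepend x ?E \<in> alternating_rels (Suc (length v))"
    proof (rule linear_map_in_subspace[where p = ?E, OF _ alternating_rels_subspace])
      fix w assume "w \<in> Poly_Mapping.keys ?E"
      then obtain z w' where "w = z # w'" "length v = Suc (length w')"
        using E[of w] False by (cases w) auto
      then show "insert_second x (word w) + prepend x (word w) \<in> alternating_rels (Suc (length v))"
        using swap_in_alternating_rels[of "[]" w'] by simp
    qed (intro comb_linear_intros)
    have "prepend x (prepend x (leibniz_via bracket_word v)) \<in> alternating_rels (Suc (length v))"
    proof (rule linear_map_in_subspace[where p = "leibniz_via bracket_word v",
          OF _ alternating_rels_subspace])
      fix w assume "w \<in> Poly_Mapping.keys (leibniz_via bracket_word v :: ('a, 'k) comb)"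
      then have "length w = length v - 1"
        using leibniz_bracket_mem_free_words by (auto simp: mem_free_words_iff)
      then show "prepend x (prepend x (word w)) \<in> alternating_rels (Suc (length v))"
        using False by (auto intro!: repeated_in_alternating_rels)
    qed (intro comb_linear_intros)
    from comb.subspace_add[OF alternating_rels_subspace comb.subspace_diff[OF alternating_rels_subspace zero swap] this]
    show ?thesis by (simp add: contract_bracket_Cons algebra_simps)
  qed
next
  case (Cons z u)
  from comb.subspace_diff[OF alternating_rels_subspace contract_bracket_adjacent[of z u x v]]
    prepend_alternating_rels[OF Cons, of z]
  show ?case by (simp add: add.commute)
qed

text \<open>
  Two equal letters at a distance are brought together by swaps, so that it suffices to consider
  equal neighbours.
\<close>

lemma repeated_in_span_adjacent:
  assumes V: "comb.subspace V" "rels n \<subseteq> V"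
    and adj: "\<And>u x v. length u + length v + 2 = n \<Longrightarrow> word (u @ x # x # v) \<in> V"
    and w: "length w = n" "\<not> distinct w"
  shows "word w \<in> V"
proof -
  have "word (u @ x # m @ x # v) \<in> V" if "length u + length m + length v + 2 = n" for u x m v
    using that
  proof (induction m arbitrary: u)
    case Nil
    then show ?case by (simp add: adj)
  next
    case (Cons y m)
    have "word (u @ x # y # m @ x # v) + word (u @ y # x # m @ x # v) \<in> V"
      using Cons.prems by (intro swap_in_subspace[OF V] adj) auto
    moreover have "word ((u @ [y]) @ x # m @ x # v) \<in> V"
      using Cons.prems by (intro Cons.IH) simp
    ultimately have "word (u @ x # y # m @ x # v) + word (u @ y # x # m @ x # v)
        - word ((u @ [y]) @ x # m @ x # v) \<in> V"
      by (rule comb.subspace_diff[OF V(1)])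
    then show ?case by simp
  qed
  moreover obtain u x m v where "w = u @ [x] @ m @ [x] @ v"
    using not_distinct_decomp[OF w(2)] by blast
  ultimately show ?thesis using w(1) by simp
qed

lemma leibniz_alternating_rels:
  assumes "p \<in> alternating_rels (Suc n)"
  shows "linear_extension leibniz_word p \<in> alternating_rels n"
proof -
  let ?V = "{p. linear_extension leibniz_word p \<in> alternating_rels n}"
  have sub: "comb.subspace ?V"
    using module_hom.subspace_linear_preimage[OF linear_extension_linear alternating_rels_subspace] .
  have rels: "rels (Suc n) \<subseteq> ?V"
    using multilinear_preserves_rels[OF multilinear_leibniz_word] rels_in_alternating_rels by blast
  have adj: "word (u @ x # x # v) \<in> ?V" if "length u + length v + 2 = Suc n" for u x v
  proof -
    have "n = length u + length v + 1" using that by simp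
    then show ?thesis using leibniz_adjacent[of u x v] by (simp add: leibniz_word_eq)
  qed
  have "p \<in> ?V"
    by (rule linear_map_alternating_rels[OF comb_linear_id sub assms])
      (use rels repeated_in_span_adjacent[OF sub rels adj] in auto)
  then show ?thesis by simp
qed

end

section \<open>Quotient groups and induced maps on homology\<close>

lemma coset_hom_Mod:
  assumes "comm_group G" "subgroup H G"
  shows "(\<lambda>x. H #>\<^bsub>G\<^esub> x) \<in> hom G (G Mod H)"
  using normal.r_coset_hom_Mod comm_group.subgroup_imp_normal assms by metis

lemma quot_map_coset_comm:
  assumes "comm_group D" "comm_group G" "subgroup K D" "subgroup H G"
    and "f \<in> hom D G" "f ` K \<subseteq> H" "x \<in> carrier D"
  shows "quot_map G H f (K #>\<^bsub>D\<^esub> x) = H #>\<^bsub>G\<^esub> f x"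
  using assms by (intro quot_map_coset) (auto simp: comm_group_def)

lemma quot_map_hom:
  assumes "comm_group D" "comm_group G" "subgroup K D" "subgroup H G"
    and f: "f \<in> hom D G" and "f ` K \<subseteq> H"
  shows "quot_map G H f \<in> hom (D Mod K) (G Mod H)"
proof -
  interpret D: comm_group D by fact
  interpret G: comm_group G by fact
  interpret K: normal K D by (rule D.subgroup_imp_normal) fact
  interpret H: normal H G by (rule G.subgroup_imp_normal) fact
  have "quot_map G H f (K #>\<^bsub>D\<^esub> x) = H #>\<^bsub>G\<^esub> f x" if "x \<in> carrier D" for x
    using assms that by (rule quot_map_coset_comm)
  moreover have "f x \<in> carrier G" if "x \<in> carrier D" for x
    using f that by (auto simp: hom_def)
  ultimately show ?thesis
    by (intro homI) (auto simp: carrier_FactGroup K.rcos_sum H.rcos_sum hom_mult[OF f])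
qed

lemma boundaries_subgroup:
  assumes "comm_group (C n)" "comm_group (C (Suc n))" "d n \<in> hom (C (Suc n)) (C n)"
  shows "subgroup (boundaries C d n) (C n)"
proof -
  interpret group_hom "C (Suc n)" "C n" "d n"
    using assms by (simp add: group_hom_def group_hom_axioms_def comm_group_def)
  show ?thesis unfolding boundaries_def by (rule img_is_subgroup)
qed

text \<open>
  The cosets of the boundaries in the group of cycles are the cosets in the group of all chains.
  The induced map can therefore be computed with the groups of chains, where the boundaries form a
  subgroup as the image of a homomorphism, and commutation with the differentials puts their images
  among the boundaries.
\<close>

lemma homology_map_coset:
  assumes groups: "comm_group (C n)" "comm_group (C (Suc n))" "comm_group (C' m)" "comm_group (C' (Suc m))"
    and d: "d n \<in> hom (C (Suc n)) (C n)" and d': "d' m \<in> hom (C' (Suc m)) (C' m)"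
    and f: "f \<in> hom (C' m) (C n)" and g: "\<And>x. x \<in> carrier (C' (Suc m)) \<Longrightarrow> g x \<in> carrier (C (Suc n))"
    and comm: "\<And>x. x \<in> carrier (C' (Suc m)) \<Longrightarrow> f (d' m x) = d n (g x)"
    and z: "z \<in> carrier (C' m)"
  shows "homology_map C d n f (boundaries C' d' m #>\<^bsub>C' m\<^esub> z) = boundaries C d n #>\<^bsub>C n\<^esub> f z"
proof -
  have "homology_map C d n f = quot_map (C n) (boundaries C d n) f"
    by (simp add: homology_map_def quot_map_def r_coset_def fun_eq_iff)
  moreover have "f ` boundaries C' d' m \<subseteq> boundaries C d n"
    using comm g by (auto simp: boundaries_def)
  ultimately show ?thesis
    using quot_map_coset_comm[OF groups(3,1) boundaries_subgroup[of C' m d', OF groups(3,4) d']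
        boundaries_subgroup[of C n d, OF groups(1,2) d] f _ z] by simp
qed

lemma homology_carrierE:
  assumes "x \<in> carrier (homology C d n)"
  obtains z where "z \<in> carrier (C n)" "x = boundaries C d n #>\<^bsub>C n\<^esub> z"
proof -
  obtain z where "z \<in> cycles C d n" "x = boundaries C d n #>\<^bsub>C n\<^esub> z"
    using assms by (auto simp: homology_def carrier_FactGroup r_coset_def)
  moreover have "cycles C d n \<subseteq> carrier (C n)" by (cases n) (auto simp: kernel_def)
  ultimately show ?thesis using that by auto
qed

lemma free_words_comm_group: "comm_group (free_words n :: ('a, 'k::field) comb monoid)"
proof -
  have sub: "comb.subspace (carrier (free_words n) :: ('a, 'k) comb set)"
    by (rule free_words_subspace)
  have mult: "p \<otimes>\<^bsub>free_words n\<^esub> q = p + q" and one: "\<one>\<^bsub>free_words n\<^esub> = (0 :: ('a, 'k) comb)"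
    for p q :: "('a, 'k) comb" by (simp_all add: free_words_def)
  show ?thesis
  proof (rule comm_groupI, unfold mult one)
    show "\<exists>q \<in> carrier (free_words n). q + p = 0" if "p \<in> carrier (free_words n)"
      for p :: "('a, 'k) comb"
      using comb.subspace_neg[OF sub that] by (intro bexI[of _ "- p"]) simp_all
  qed (simp_all add: comb.subspace_add[OF sub] comb.subspace_0[OF sub] ac_simps)
qed

lemma subspace_subgroup:
  fixes V :: "('a, 'k::field) comb set"
  assumes "comb.subspace V" "V \<subseteq> carrier (free_words n)"
  shows "subgroup V (free_words n)"
proof -
  interpret comm_group "free_words n :: ('a, 'k) comb monoid" by (rule free_words_comm_group)
  have "inv\<^bsub>free_words n\<^esub> p = - p" if "p \<in> V" for p
    using that assms comb.subspace_neg[OF free_words_subspace]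
    by (intro inv_equality) (auto simp: free_words_def)
  then show ?thesis
    using assms comb.subspace_neg[OF assms(1)] comb.subspace_add[OF assms(1)] comb.subspace_0[OF assms(1)]
    by (intro subgroupI) (auto simp: free_words_def)
qed

lemma linear_extension_hom:
  assumes "\<And>w. length w = n \<Longrightarrow> f w \<in> carrier (free_words m)"
  shows "linear_extension f \<in> hom (free_words n) (free_words m)"
proof (rule homI)
  show "linear_extension f p \<in> carrier (free_words m)" if "p \<in> carrier (free_words n)" for p
    using linear_extension_mem_subspace[OF free_words_subspace that] assms by blast
qed (simp add: free_words_def)

section \<open>The complexes and the maps between them\<close>

context assoc_algebra
begin

lemma multilinear_cyclic_word: "multilinear (Suc n) (Suc n) cyclic_word"
  unfolding multilinear_def
proof (intro allI impI)
  fix u v :: "'a list" assume n: "length u + 1 + length v = Suc n"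
  have "linear_mod (rels (Suc n)) (\<lambda>x. word (last (u @ x # v) # butlast (u @ x # v)))"
  proof (cases "v = []")
    case True
    then show ?thesis using linear_mod_word[of "[]" u] n by (simp add: butlast_append)
  next
    case False
    then have "length (last v # u) + 1 + length (butlast v) = Suc n" using n by (cases v) auto
    from linear_mod_word[OF this] show ?thesis using False by (simp add: butlast_append)
  qed
  from linear_mod_scale[OF rels_subspace this, of "(- 1) ^ n"]
  show "linear_mod (rels (Suc n)) (\<lambda>x. cyclic_word (u @ x # v))"
    using n by (simp add: cyclic_word_def)
qed

lemma multilinear_one_minus_t_word: "multilinear (Suc n) (Suc n) one_minus_t_word"
  by (intro multilinear_diff multilinear_word multilinear_cyclic_word)

lemma rels_subgroup: "subgroup (rels n) (free_words n)"
  by (rule subspace_subgroup[OF rels_subspace rels_subset_free_words])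

abbreviation tensor_class :: "nat \<Rightarrow> ('a, 'k) comb \<Rightarrow> ('a, 'k) comb set" where
  "tensor_class n p \<equiv> rels n #>\<^bsub>free_words n\<^esub> p"

lemma tensor_power_comm_group: "comm_group (tensor_power scale n)"
  unfolding tensor_power_def
  by (rule comm_group.abelian_FactGroup[OF free_words_comm_group rels_subgroup])

lemma carrier_tensor_power: "carrier (tensor_power scale n) = tensor_class n ` carrier (free_words n)"
  by (simp add: tensor_power_def carrier_FactGroup)

lemma tensor_class_hom: "tensor_class n \<in> hom (free_words n) (tensor_power scale n)"
  unfolding tensor_power_def by (rule coset_hom_Mod[OF free_words_comm_group rels_subgroup])

lemma tensor_class_eqI:
  assumes "p - q \<in> rels n" "q \<in> carrier (free_words n)"
  shows "tensor_class n p = tensor_class n q"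
proof -
  interpret comm_group "free_words n :: ('a, 'k) comb monoid" by (rule free_words_comm_group)
  have "p \<in> tensor_class n q"
    using assms(1) by (auto simp: r_coset_def free_words_def intro!: bexI[of _ "p - q"])
  then show ?thesis using repr_independence assms(2) rels_subgroup by metis
qed

lemma tensor_map_class:
  assumes "multilinear n m f" "\<And>w. length w = n \<Longrightarrow> f w \<in> carrier (free_words m)"
    and "p \<in> carrier (free_words n)"
  shows "tensor_map scale m f (tensor_class n p) = tensor_class m (linear_extension f p)"
  unfolding tensor_map_def
  using assms multilinear_preserves_rels[OF assms(1)]
  by (intro quot_map_coset_comm free_words_comm_group rels_subgroup linear_extension_hom) auto

lemma tensor_map_hom:
  assumes "multilinear n m f" "\<And>w. length w = n \<Longrightarrow> f w \<in> carrier (free_words m)"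
  shows "tensor_map scale m f \<in> hom (tensor_power scale n) (tensor_power scale m)"
  unfolding tensor_map_def tensor_power_def
  using assms multilinear_preserves_rels[OF assms(1)]
  by (intro quot_map_hom free_words_comm_group rels_subgroup linear_extension_hom) auto

lemma leibniz_word_mem: "length w = Suc n \<Longrightarrow> (leibniz_word w :: ('a, 'k) comb) \<in> carrier (free_words n)"
  using leibniz_bracket_mem_free_words[of w] by (simp add: leibniz_word_eq)

lemma hochschild_word_mem:
  "length w = Suc (Suc n) \<Longrightarrow> (hochschild_word w :: ('a, 'k) comb) \<in> carrier (free_words (Suc n))"
  unfolding hochschild_word_def
  by (intro comb.subspace_sum[OF free_words_subspace] single_mem_free_words) (auto simp: face_def)

lemma antisym_word_mem:
  "length w = Suc n \<Longrightarrow> (antisym_word w :: ('a, 'k) comb) \<in> carrier (free_words (Suc n))"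
  unfolding antisym_word_def
  by (auto intro!: comb.subspace_sum[OF free_words_subspace] single_mem_free_words)

lemma one_minus_t_word_mem:
  "length w = Suc n \<Longrightarrow> (one_minus_t_word w :: ('a, 'k) comb) \<in> carrier (free_words (Suc n))"
  unfolding cyclic_word_def
  by (auto intro!: comb.subspace_diff[OF free_words_subspace] single_mem_free_words)

lemmas leibniz_class = tensor_map_class[OF multilinear_leibniz_word leibniz_word_mem, folded CL_d_def]
lemmas hochschild_class =
  tensor_map_class[OF multilinear_hochschild_word hochschild_word_mem, folded CHH_b_def]
lemmas phi_class = tensor_map_class[OF multilinear_antisym_word antisym_word_mem, folded phi_def]
lemmas one_minus_t_class = tensor_map_class[OF multilinear_one_minus_t_word one_minus_t_word_mem]

lemmas CL_d_hom = tensor_map_hom[OF multilinear_leibniz_word leibniz_word_mem, folded CL_d_def]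
lemmas CHH_b_hom =
  tensor_map_hom[OF multilinear_hochschild_word hochschild_word_mem, folded CHH_b_def CHH_def]
lemma phi_hom: "phi scale n \<in> hom (tensor_power scale (Suc n)) (CHH scale n)"
  unfolding phi_def CHH_def by (rule tensor_map_hom[OF multilinear_antisym_word antisym_word_mem])

lemma CHH_comm_group: "comm_group (CHH scale n)"
  by (simp add: CHH_def tensor_power_comm_group)

text \<open>
  The congruence \<open>antisym_leibniz_cong_hochschild_antisym\<close>, extended linearly from words.
\<close>

lemma phi_chain_map:
  assumes "x \<in> carrier (tensor_power scale (Suc (Suc n)))"
  shows "phi scale n (CL_d scale (Suc n) x) = CHH_b scale n (phi scale (Suc n) x)"
proof -
  obtain p where p: "p \<in> carrier (free_words (Suc (Suc n)))" and x: "x = tensor_class (Suc (Suc n)) p"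
    using assms by (auto simp: carrier_tensor_power)
  have leib: "linear_extension leibniz_word p \<in> carrier (free_words (Suc n))"
    and anti: "linear_extension antisym_word p \<in> carrier (free_words (Suc (Suc n)))"
    using p by (auto intro: linear_extension_mem_subspace[OF free_words_subspace] leibniz_word_mem antisym_word_mem)
  have hoch: "linear_extension hochschild_word (linear_extension antisym_word p) \<in> carrier (free_words (Suc n))"
    using anti by (auto intro: linear_extension_mem_subspace[OF free_words_subspace] hochschild_word_mem)
  have "linear_extension antisym_word (linear_extension leibniz_word p)
      - linear_extension hochschild_word (linear_extension antisym_word p) \<in> rels (Suc n)"
    by (rule linear_map_in_subspace[where p = p], (intro comb_linear_intros)+, rule rels_subspace)
      (use p in \<open>simp add: mem_free_words_iff antisym_leibniz_cong_hochschild_antisym\<close>)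
  then show ?thesis
    using tensor_class_eqI[OF _ hoch] by (simp add: x p leib anti leibniz_class phi_class hochschild_class)
qed

lemma alternating_subspace_eq: "alternating_subspace scale n = tensor_class n ` repeated n"
  by (simp add: alternating_subspace_def repeated_def)

lemma repeated_subspace: "comb.subspace (repeated n)"
  by (simp add: repeated_def)

lemma repeated_subset: "repeated n \<subseteq> carrier (free_words n)"
  unfolding repeated_def
  by (rule comb.span_minimal[OF _ free_words_subspace]) (auto intro: single_mem_free_words)

lemma alternating_subspace_subgroup: "subgroup (alternating_subspace scale n) (tensor_power scale n)"
proof -
  interpret group_hom "free_words n" "tensor_power scale n" "tensor_class n"
    using free_words_comm_group tensor_power_comm_group tensor_class_hom
    by (auto simp: group_hom_def group_hom_axioms_def comm_group_def)
  show ?thesis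
    unfolding alternating_subspace_eq
    by (rule subgroup_img_is_subgroup[OF subspace_subgroup[OF repeated_subspace repeated_subset]])
qed

text \<open>
  A combination in \<open>alternating_rels n\<close> may be replaced by one in \<open>repeated n\<close> without changing its
  class in the tensor power.
\<close>

lemma class_in_alternating_subspace:
  assumes "p \<in> alternating_rels n"
  shows "tensor_class n p \<in> alternating_subspace scale n"
proof -
  have spans: "comb.span (rels n) = rels n" "comb.span (repeated n) = repeated n"
    using rels_subspace repeated_subspace by (simp_all only: comb.span_eq_iff)
  obtain r s where "r \<in> rels n" and s: "s \<in> repeated n" and "p = r + s"
    using assms unfolding alternating_rels_def comb.span_Un spans by blast
  then have "tensor_class n p = tensor_class n s"
    using repeated_subset by (intro tensor_class_eqI) auto
  then show ?thesis using s by (simp add: alternating_subspace_eq)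
qed

lemma CL_d_alternating: "CL_d scale n ` alternating_subspace scale (Suc n) \<subseteq> alternating_subspace scale n"
proof (clarsimp simp: alternating_subspace_eq[of "Suc n"])
  fix p assume p: "p \<in> repeated (Suc n)"
  then have "p \<in> alternating_rels (Suc n)" by (simp add: alternating_rels_def comb.span_base)
  then show "CL_d scale n (tensor_class (Suc n) p) \<in> alternating_subspace scale n"
    using p repeated_subset by (simp add: leibniz_class subset_iff class_in_alternating_subspace leibniz_alternating_rels)
qed

lemma exterior_power_comm_group: "comm_group (exterior_power scale n)"
  unfolding exterior_power_def
  by (rule comm_group.abelian_FactGroup[OF tensor_power_comm_group alternating_subspace_subgroup])

lemma exterior_d_class:
  "x \<in> carrier (tensor_power scale (Suc n)) \<Longrightarrow>
    exterior_d scale n (alternating_subspace scale (Suc n) #>\<^bsub>tensor_power scale (Suc n)\<^esub> x)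
      = alternating_subspace scale n #>\<^bsub>tensor_power scale n\<^esub> CL_d scale n x"
  unfolding exterior_d_def
  by (intro quot_map_coset_comm tensor_power_comm_group alternating_subspace_subgroup CL_d_hom CL_d_alternating)

lemma exterior_d_hom: "exterior_d scale n \<in> hom (exterior_power scale (Suc n)) (exterior_power scale n)"
  unfolding exterior_d_def exterior_power_def
  by (intro quot_map_hom tensor_power_comm_group alternating_subspace_subgroup CL_d_hom CL_d_alternating)

lemma one_minus_t_image_eq: "one_minus_t_image scale n = tensor_class (Suc n) ` cyclic_image (Suc n)"
  unfolding one_minus_t_image_def cyclic_image_def CHH_def carrier_tensor_power image_image
  by (rule image_cong) (simp_all add: one_minus_t_class)

lemma cyclic_image_subset: "cyclic_image (Suc n) \<subseteq> (carrier (free_words (Suc n)) :: ('a, 'k) comb set)"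
  unfolding cyclic_image_def
  by (auto intro: linear_extension_mem_subspace[OF free_words_subspace] one_minus_t_word_mem)

lemma one_minus_t_image_subgroup: "subgroup (one_minus_t_image scale n) (CHH scale n)"
proof -
  interpret group_hom "free_words (Suc n)" "tensor_power scale (Suc n)" "tensor_class (Suc n)"
    using free_words_comm_group tensor_power_comm_group tensor_class_hom
    by (auto simp: group_hom_def group_hom_axioms_def comm_group_def)
  show ?thesis
    unfolding one_minus_t_image_eq CHH_def
    by (rule subgroup_img_is_subgroup[OF subspace_subgroup[OF cyclic_image_subspace cyclic_image_subset]])
qed

lemma CHH_b_one_minus_t: "CHH_b scale n ` one_minus_t_image scale (Suc n) \<subseteq> one_minus_t_image scale n"
  using cyclic_image_subset hochschild_cyclic_image
  by (fastforce simp: one_minus_t_image_eq hochschild_class)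

lemma Clambda_comm_group: "comm_group (Clambda scale n)"
  unfolding Clambda_def
  by (rule comm_group.abelian_FactGroup[OF CHH_comm_group one_minus_t_image_subgroup])

lemma Clambda_b_class:
  "x \<in> carrier (CHH scale (Suc n)) \<Longrightarrow>
    Clambda_b scale n (one_minus_t_image scale (Suc n) #>\<^bsub>CHH scale (Suc n)\<^esub> x)
      = one_minus_t_image scale n #>\<^bsub>CHH scale n\<^esub> CHH_b scale n x"
  unfolding Clambda_b_def
  by (intro quot_map_coset_comm CHH_comm_group one_minus_t_image_subgroup CHH_b_hom CHH_b_one_minus_t)

lemma Clambda_b_hom: "Clambda_b scale n \<in> hom (Clambda scale (Suc n)) (Clambda scale n)"
  unfolding Clambda_b_def Clambda_def
  by (intro quot_map_hom CHH_comm_group one_minus_t_image_subgroup CHH_b_hom CHH_b_one_minus_t)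

end

locale assoc_algebra_char_0 = assoc_algebra scale
  for scale :: "'k::field_char_0 \<Rightarrow> 'a::ring \<Rightarrow> 'a"
begin

lemma phi_alternating: "phi scale n ` alternating_subspace scale (Suc n) \<subseteq> one_minus_t_image scale n"
proof (clarsimp simp: alternating_subspace_eq one_minus_t_image_eq)
  fix p assume p: "p \<in> repeated (Suc n)"
  have "linear_extension antisym_word p \<in> cyclic_image (Suc n)"
    using p unfolding repeated_def
    by (rule span_linear_image[OF linear_extension_linear cyclic_image_subspace, rotated])
      (use antisym_word_not_distinct in fastforce)
  then show "phi scale n (tensor_class (Suc n) p) \<in> tensor_class (Suc n) ` cyclic_image (Suc n)"
    using p repeated_subset by (simp add: phi_class subset_iff)
qed

lemma theta_class:
  "x \<in> carrier (tensor_power scale (Suc n)) \<Longrightarrow>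
    theta scale n (alternating_subspace scale (Suc n) #>\<^bsub>tensor_power scale (Suc n)\<^esub> x)
      = one_minus_t_image scale n #>\<^bsub>CHH scale n\<^esub> phi scale n x"
  unfolding theta_def phi_def[symmetric]
  by (intro quot_map_coset_comm CHH_comm_group tensor_power_comm_group alternating_subspace_subgroup
      one_minus_t_image_subgroup phi_hom phi_alternating)

lemma theta_hom: "theta scale n \<in> hom (exterior_power scale (Suc n)) (Clambda scale n)"
  unfolding theta_def phi_def[symmetric] exterior_power_def Clambda_def
  by (intro quot_map_hom CHH_comm_group tensor_power_comm_group alternating_subspace_subgroup
      one_minus_t_image_subgroup phi_hom phi_alternating)

end

section \<open>The commuting square\<close>

theorem lemma2p4:
  fixes scale :: "'k::field_char_0 \<Rightarrow> 'a::ring \<Rightarrow> 'a" and n :: nat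
  assumes "assoc_algebra scale"
  shows "\<forall>\<xi> \<in> carrier (HL scale (Suc n)).
           I_star scale n (phi_star scale n \<xi>) = theta_star scale n (pi_star scale (Suc n) \<xi>)"
proof
  interpret assoc_algebra_char_0 scale using assms by (simp add: assoc_algebra_char_0_def)
  let ?A = "\<lambda>n x. alternating_subspace scale n #>\<^bsub>tensor_power scale n\<^esub> x"
  let ?Z = "\<lambda>n x. one_minus_t_image scale n #>\<^bsub>CHH scale n\<^esub> x"
  let ?BL = "\<lambda>x. boundaries (tensor_power scale) (CL_d scale) (Suc n) #>\<^bsub>tensor_power scale (Suc n)\<^esub> x"
  let ?BH = "\<lambda>x. boundaries (CHH scale) (CHH_b scale) n #>\<^bsub>CHH scale n\<^esub> x"
  let ?BE = "\<lambda>x. boundaries (exterior_power scale) (exterior_d scale) (Suc n) #>\<^bsub>exterior_power scale (Suc n)\<^esub> x"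
  let ?BC = "\<lambda>x. boundaries (Clambda scale) (Clambda_b scale) n #>\<^bsub>Clambda scale n\<^esub> x"
  fix \<xi> assume "\<xi> \<in> carrier (HL scale (Suc n))"
  then obtain z where z: "z \<in> carrier (tensor_power scale (Suc n))" and \<xi>: "\<xi> = ?BL z"
    unfolding HL_def by (rule homology_carrierE)
  have phi_mem: "phi scale m x \<in> carrier (CHH scale m)" if "x \<in> carrier (tensor_power scale (Suc m))" for m x
    using phi_hom that by (auto simp: hom_def CHH_def)
  have A_hom: "?A m \<in> hom (tensor_power scale m) (exterior_power scale m)" for m
    unfolding exterior_power_def by (rule coset_hom_Mod[OF tensor_power_comm_group alternating_subspace_subgroup])
  have Z_hom: "?Z m \<in> hom (CHH scale m) (Clambda scale m)" for m
    unfolding Clambda_def by (rule coset_hom_Mod[OF CHH_comm_group one_minus_t_image_subgroup])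
  have A_mem: "?A m x \<in> carrier (exterior_power scale m)" if "x \<in> carrier (tensor_power scale m)" for m x
    using A_hom that by (rule hom_in_carrier)
  have Z_mem: "?Z m x \<in> carrier (Clambda scale m)" if "x \<in> carrier (CHH scale m)" for m x
    using Z_hom that by (rule hom_in_carrier)
  have "phi_star scale n \<xi> = ?BH (phi scale n z)"
    unfolding phi_star_def \<xi>
    by (rule homology_map_coset[where g = "phi scale (Suc n)"])
      (use z phi_mem phi_chain_map in \<open>simp_all add: CHH_comm_group tensor_power_comm_group CHH_b_hom
        CL_d_hom phi_hom\<close>)
  moreover have "I_star scale n (?BH (phi scale n z)) = ?BC (?Z n (phi scale n z))"
    unfolding I_star_def
    by (rule homology_map_coset[where g = "?Z (Suc n)"])
      (use phi_mem[OF z] in \<open>simp_all add: CHH_comm_group Clambda_comm_group CHH_b_hom Clambda_b_hom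
        Clambda_b_class Z_hom Z_mem\<close>)
  moreover have "pi_star scale (Suc n) \<xi> = ?BE (?A (Suc n) z)"
    unfolding pi_star_def \<xi>
    by (rule homology_map_coset[where g = "?A (Suc (Suc n))"])
      (use z in \<open>simp_all add: tensor_power_comm_group exterior_power_comm_group CL_d_hom exterior_d_hom
        exterior_d_class A_hom A_mem\<close>)
  moreover have "theta_star scale n (?BE (?A (Suc n) z)) = ?BC (theta scale n (?A (Suc n) z))"
    unfolding theta_star_def
  proof (rule homology_map_coset[where g = "theta scale (Suc n)"])
    fix y assume "y \<in> carrier (exterior_power scale (Suc (Suc n)))"
    then obtain x where x: "x \<in> carrier (tensor_power scale (Suc (Suc n)))" and y: "y = ?A (Suc (Suc n)) x"
      by (auto simp: exterior_power_def carrier_FactGroup)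
    have "CL_d scale (Suc n) x \<in> carrier (tensor_power scale (Suc n))"
      using CL_d_hom x by (rule hom_in_carrier)
    then show "theta scale n (exterior_d scale (Suc n) y) = Clambda_b scale n (theta scale (Suc n) y)"
      using x phi_mem by (simp add: y exterior_d_class theta_class Clambda_b_class phi_chain_map)
    show "theta scale (Suc n) y \<in> carrier (Clambda scale (Suc n))"
      using x phi_mem Z_mem by (simp add: y theta_class)
  qed (use A_mem[OF z] in \<open>simp_all add: Clambda_comm_group exterior_power_comm_group Clambda_b_hom
      exterior_d_hom theta_hom\<close>)
  ultimately show "I_star scale n (phi_star scale n \<xi>) = theta_star scale n (pi_star scale (Suc n) \<xi>)"
    using z by (simp add: theta_class)
qed

end
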